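(* Let the Smoothness, Hessian, Gradient and Merit-parameter Assumptions of the context hold for the iterates generated by the exact algorithm of the context. Let $\alpha_k\in[\nu,\nu+\theta\beta_k]$ for all $k$, where $\theta>0$ and $$\nu\in\Big(0,\min\Big\{\frac{\sigma\kappa_v\kappa_c^{-1}}{2(\tau_{\min}L+\Gamma)\omega^2},\,1-\theta\kappa_\beta\Big\}\Big].$$ For any $K\in\mathbb N$, let $\beta_k:=\beta=\eta/\sqrt K$ for all $k\in[0,K-1]$, where $\eta>0$. Let $\kappa_2:=\tau_{\min}(f_0-f_{\inf})+\|c_0\|+\eta^2\kappa_1$. Then $$\frac1K\sum_{k=0}^{K-1}\mathbb E\big[\|J_k^Tc_k\|^2\big]\le\frac{2\kappa_c\kappa_2}{\nu\sigma\kappa_vK}.$$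
   Context: Problem: minimize $f(x)$ over $x\in\mathbb R^n$ subject to $c(x)=0$, with $f:\mathbb R^n\to\mathbb R$ (an expectation) and $c:\mathbb R^n\to\mathbb R^m$. $\|\cdot\|$ is the Euclidean norm (and induced matrix norm). $J(x)=\nabla c(x)^T\in\mathbb R^{m\times n}$, $c_k=c(x_k)$, $J_k=J(x_k)$, $f_0=f(x_0)$. Smoothness Assumption: there is an open convex set $\mathcal X\subset\mathbb R^n$ containing all iterates $x_k$; on $\mathcal X$, $f$ is continuously differentiable and bounded, $\nabla f$ is bounded and Lipschitz with constant $L>0$, $c$ is continuously differentiable and bounded, $J$ is bounded and Lipschitz with constant $\Gamma>0$. Consequently there are constants $f_{\inf}\in\mathbb R$, $\kappa_g,\kappa_c,\kappa_J>0$ with $f_{\inf}\le f(x_k)$, $\|\nabla f(x_k)\|\le\kappa_g$, $\|c_k\|\le\kappa_c$, $\|J_k\|\le\kappa_J$ for all $k$; these are fixed. Hessian Assumption: for all $k$, $H_k$ is a symmetric $n\times n$ matrix chosen independently from $g_k$, $\|H_k\|\le\kappa_H$, and there is $\zeta>0$ with $u^TH_ku\ge\zeta\|u\|^2$ for all $u\in\mathrm{Null}(J_k)$. Gradient Assumption: for all $k$, the stochastic gradient estimate $g_k$ satisfies $\mathbb E_k[g_k]=\nabla f(x_k)$ and $\mathbb E_k[\|g_k-\nabla f(x_k)\|^2]\le M$ for some $M>0$, where $\mathbb E_k$ is the conditional expectation given the history up to $x_k$ (under which $x_k,v_k,H_k,\beta_k$ are treated as known). Exact algorithm: given $x_0$,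 at iteration $k$: (1) compute $v_k\in\mathrm{Range}(J_k^T)$, independently of $g_k$, as an approximate solution of $\min_v\frac12\|c_k+J_kv\|^2$ s.t. $\|v\|\le\omega\|J_k^Tc_k\|$ (with $\omega>0$ fixed) that is feasible and satisfies the Cauchy decrease condition $\|c_k\|-\|c_k+J_kv_k\|\ge\epsilon_v(\|c_k\|-\|c_k+\alpha_k^CJ_kv_k^C\|)$, where $\epsilon_v\in(0,1]$ is fixed, $v_k^C=-J_k^Tc_k$, and $\alpha_k^C$ minimizes $\frac12\|c_k+\alpha J_kv_k^C\|^2$ over $\alpha\le\omega$; (2) draw $g_k$ and let $u_k$ be the unique minimizer of $(g_k+H_kv_k)^Tu+\frac12u^TH_ku$ s.t. $J_ku=0$; (3) with a predefined $\beta_k>0$, $\beta_k\le\kappa_\beta$ for all $k$ ($\kappa_\beta>0$ a constant), set $d_k=\beta_ku_k+v_k$; (4) choose $\alpha_k>0$ and set $x_{k+1}=x_k+\alpha_kd_k$. The stepsize $\alpha_k$ may depend on $g_k$. True quantities: $u_k^{\mathrm{true}}$ is the minimizer of $(\nabla f(x_k)+H_kv_k)^Tu+\frac12u^TH_ku$ s.t. $J_ku=0$, and $d_k^{\mathrm{true}}=\beta_ku_k^{\mathrm{true}}+v_k$. Merit-parameter Assumption (with fixed $\sigma\in(0,1)$): there is $\tau_{\min}>0$ such that for all $k$, $\tau_{\min}(\nabla f(x_k)^Td_k^{\mathrm{true}}+\beta_k(u_k^{\mathrm{true}})^TH_ku_k^{\mathrm{true}})\le(1-\sigma)(\|c_k\|-\|c_k+J_kv_k\|)$.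 Constants: $\kappa_v>0$ is a constant such that $\|c_k\|(\|c_k\|-\|c_k+J_kv_k\|)\ge\kappa_v\|J_k^Tc_k\|^2$ for all $k$ (such a constant exists under the Smoothness Assumption); $\kappa_u:=\zeta^{-1}(\kappa_g+\kappa_H\omega\kappa_J\kappa_c)$; $\kappa_1:=\frac12(\tau_{\min}L+\Gamma)(\zeta^{-1}\kappa_H\kappa_u^2+\zeta^{-2}M)+\theta\kappa_g\tau_{\min}\zeta^{-1}\sqrt M+\theta^2(\tau_{\min}L+\Gamma)\omega^2\kappa_J^2\kappa_c^2$. *)

theory Defs
  imports "HOL-Probability.Probability"
begin

text \<open>The induced (spectral) matrix norm; the library's \<open>norm\<close> on matrices is the Frobenius norm.\<close>
abbreviation opnorm :: "real^'n^'m \<Rightarrow> real" where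
  "opnorm A \<equiv> onorm (\<lambda>z. A *v z)"

text \<open>\<open>gradf x\<close> is the gradient of \<open>f\<close> and \<open>J x\<close> the Jacobian matrix of \<open>c\<close>; both are
  determined by \<open>f\<close> and \<open>c\<close> on the open set \<open>X\<close> and irrelevant outside it.\<close>
definition smoothness_assumption ::
  "(real^'n) set \<Rightarrow> (real^'n \<Rightarrow> real) \<Rightarrow> (real^'n \<Rightarrow> real^'n) \<Rightarrow>
   (real^'n \<Rightarrow> real^'m) \<Rightarrow> (real^'n \<Rightarrow> real^'n^'m) \<Rightarrow> real \<Rightarrow> real \<Rightarrow> bool" where
  "smoothness_assumption X f gradf c J L \<Gamma> \<longleftrightarrow>
     open X \<and> convex X \<and>
     (\<forall>x\<in>X. GDERIV f x :> gradf x) \<and> continuous_on X gradf \<and>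
     bounded (f ` X) \<and> bounded (gradf ` X) \<and> L > 0 \<and>
     (\<forall>x\<in>X. \<forall>y\<in>X. norm (gradf x - gradf y) \<le> L * norm (x - y)) \<and>
     (\<forall>x\<in>X. (c has_derivative (\<lambda>h. J x *v h)) (at x)) \<and> continuous_on X J \<and>
     bounded (c ` X) \<and> bounded (J ` X) \<and> \<Gamma> > 0 \<and>
     (\<forall>x\<in>X. \<forall>y\<in>X. opnorm (J x - J y) \<le> \<Gamma> * norm (x - y))"

definition tangential_step ::
  "real^'n \<Rightarrow> real^'n^'n \<Rightarrow> real^'n \<Rightarrow> real^'n^'m \<Rightarrow> real^'n \<Rightarrow> bool" where
  "tangential_step g H v J u \<longleftrightarrow>
     is_arg_min (\<lambda>w. (g + H *v v) \<bullet> w + (1/2) * (w \<bullet> (H *v w))) (\<lambda>w. J *v w = 0) u"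

text \<open>\<open>a\<close> is the Cauchy stepsize; its minimization is over \<open>t \<le> \<omega>\<close> with no lower bound on \<open>t\<close>.\<close>
definition normal_step ::
  "real \<Rightarrow> real \<Rightarrow> real^'m \<Rightarrow> real^'n^'m \<Rightarrow> real \<Rightarrow> real^'n \<Rightarrow> bool" where
  "normal_step \<omega> \<epsilon>\<^sub>v c J a v \<longleftrightarrow>
     v \<in> range (\<lambda>y. transpose J *v y) \<and>
     norm v \<le> \<omega> * norm (transpose J *v c) \<and>
     (let v\<^sub>C = - (transpose J *v c) in
        is_arg_min (\<lambda>t. (1/2) * (norm (c + t *\<^sub>R (J *v v\<^sub>C)))^2) (\<lambda>t. t \<le> \<omega>) a \<and>
        norm c - norm (c + J *v v) \<ge> \<epsilon>\<^sub>v * (norm c - norm (c + a *\<^sub>R (J *v v\<^sub>C))))"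

definition vec_cond_exp ::
  "'w measure \<Rightarrow> 'w measure \<Rightarrow> ('w \<Rightarrow> real^'n) \<Rightarrow> 'w \<Rightarrow> real^'n" where
  "vec_cond_exp P F g \<xi> = (\<chi> i. real_cond_exp P F (\<lambda>\<xi>. g \<xi> $ i) \<xi>)"

text \<open>\<open>F\<close> is the \<open>\<sigma>\<close>-algebra of the history.  The second moment is taken in the extended
  nonnegative reals because \<open>real_cond_exp\<close> sends an infinite conditional expectation to 0.\<close>
definition gradient_assumption ::
  "'w measure \<Rightarrow> 'w measure \<Rightarrow> ('w \<Rightarrow> real^'n) \<Rightarrow> ('w \<Rightarrow> real^'n) \<Rightarrow> real \<Rightarrow> bool" where
  "gradient_assumption P F g gradf M \<longleftrightarrow>
     (AE \<xi> in P. vec_cond_exp P F g \<xi> = gradf \<xi>) \<and>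
     (AE \<xi> in P. nn_cond_exp P F (\<lambda>\<xi>. ennreal ((norm (g \<xi> - gradf \<xi>))^2)) \<xi> \<le> ennreal M)"

end

theory Submission
  imports Defs
begin

text \<open>Along the algorithm the merit function \<open>\<phi> = \<tau>\<^sub>m\<^sub>i\<^sub>n f + \<parallel>c\<parallel>\<close> satisfies a pointwise decrease: the
  Taylor bounds for \<open>f\<close> and \<open>c\<close>, the orthogonality of \<open>u\<^sub>k \<in> Null J\<^sub>k\<close> and \<open>v\<^sub>k \<in> Range J\<^sub>k\<^sup>T\<close>, and the
  merit-parameter assumption bound \<open>\<phi>(x\<^sub>k\<^sub>+\<^sub>1) - \<phi>(x\<^sub>k)\<close> by a negative multiple of
  \<open>\<parallel>J\<^sub>k\<^sup>T c\<^sub>k\<parallel>\<^sup>2\<close>, terms of order \<open>\<beta>\<^sub>k\<^sup>2\<close>, and \<open>y\<^sub>k \<bullet> (u\<^sub>k - u\<^sub>k\<^sup>t\<^sup>r\<^sup>u\<^sup>e)\<close> with \<open>y\<^sub>k\<close> known at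
  time \<open>k\<close>. The part of \<open>\<alpha>\<^sub>k\<close> that depends on \<open>g\<^sub>k\<close> is at most \<open>\<theta> \<beta>\<^sub>k\<close> and enters only the second group.
  Since \<open>u\<^sub>k - u\<^sub>k\<^sup>t\<^sup>r\<^sup>u\<^sup>e\<close> is a symmetric linear image of the gradient noise, the last term equals
  \<open>-w\<^sub>k \<bullet> (g\<^sub>k - \<nabla>f(x\<^sub>k))\<close>, where \<open>w\<^sub>k\<close> solves the reduced system with right-hand side \<open>y\<^sub>k\<close>; it has
  mean zero once \<open>w\<^sub>k\<close> is known to be measurable with respect to the history. Summing the expected
  decrease over \<open>k < K\<close> telescopes.\<close>

section \<open>Measurability of vector, matrix and determinant expressions\<close>

lemma borel_measurable_vec_iff:
  fixes f :: "'w \<Rightarrow> 'a::euclidean_space^'n"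
  shows "f \<in> borel_measurable M \<longleftrightarrow> (\<forall>i. (\<lambda>x. f x $ i) \<in> borel_measurable M)"
proof
  assume f: "f \<in> borel_measurable M"
  show "\<forall>i. (\<lambda>x. f x $ i) \<in> borel_measurable M"
    by (intro allI measurable_compose[OF f] borel_measurable_continuous_onI continuous_intros)
next
  assume f: "\<forall>i. (\<lambda>x. f x $ i) \<in> borel_measurable M"
  show "f \<in> borel_measurable M"
  proof (rule iffD2[OF borel_measurable_euclidean_space], rule ballI)
    fix e :: "'a^'n" assume "e \<in> Basis"
    then obtain i b where e: "e = axis i b" by (auto simp: Basis_vec_def)
    have "(\<lambda>x. f x $ i \<bullet> b) \<in> borel_measurable M"
      using f by (intro borel_measurable_inner) auto
    then show "(\<lambda>x. f x \<bullet> e) \<in> borel_measurable M" by (simp add: e inner_axis)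
  qed
qed

lemma borel_measurable_matrix_iff:
  fixes A :: "'w \<Rightarrow> real^'n^'m"
  shows "A \<in> borel_measurable M \<longleftrightarrow> (\<forall>i j. (\<lambda>x. A x $ i $ j) \<in> borel_measurable M)"
  by (simp add: borel_measurable_vec_iff)

lemma borel_measurable_matrix_vector_mult:
  fixes A :: "'w \<Rightarrow> real^'n^'m"
  assumes "A \<in> borel_measurable M" "b \<in> borel_measurable M"
  shows "(\<lambda>x. A x *v b x) \<in> borel_measurable M"
  using assms unfolding borel_measurable_vec_iff matrix_vector_mult_def
  by (auto intro!: borel_measurable_sum borel_measurable_times)

lemma borel_measurable_matrix_mult:
  fixes A :: "'w \<Rightarrow> real^'n^'m" and B :: "'w \<Rightarrow> real^'k^'n"
  assumes "A \<in> borel_measurable M" "B \<in> borel_measurable M"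
  shows "(\<lambda>x. A x ** B x) \<in> borel_measurable M"
  using assms unfolding borel_measurable_vec_iff matrix_matrix_mult_def
  by (auto intro!: borel_measurable_sum borel_measurable_times)

lemma borel_measurable_transpose:
  fixes A :: "'w \<Rightarrow> real^'n^'m"
  assumes "A \<in> borel_measurable M"
  shows "(\<lambda>x. transpose (A x)) \<in> borel_measurable M"
  using assms unfolding borel_measurable_vec_iff transpose_def by auto

lemma borel_measurable_det:
  fixes A :: "'w \<Rightarrow> real^'n^'n"
  assumes "A \<in> borel_measurable M"
  shows "(\<lambda>x. det (A x)) \<in> borel_measurable M"
  using assms unfolding borel_measurable_vec_iff det_def
  by (auto intro!: borel_measurable_sum borel_measurable_times borel_measurable_prod)

text \<open>Cramer's rule writes each coordinate of the unique solution as a quotient of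
  determinants, hence as a measurable function of the entries of \<open>A\<close> and
  \<open>b\<close>. Injectivity of \<open>A \<xi>\<close> forces the pointwise choice
  \<open>y\<close> to agree with this formula.\<close>

lemma borel_measurable_linear_solution:
  fixes A :: "'w \<Rightarrow> real^'n^'n"
  assumes A: "A \<in> borel_measurable M" and b: "b \<in> borel_measurable M"
    and inj: "\<And>\<xi> z. \<xi> \<in> space M \<Longrightarrow> A \<xi> *v z = 0 \<Longrightarrow> z = 0"
    and y: "\<And>\<xi>. \<xi> \<in> space M \<Longrightarrow> A \<xi> *v y \<xi> = b \<xi>"
  shows "y \<in> borel_measurable M"
proof -
  have sol: "y \<xi> = (\<chi> k. det (\<chi> i j. if j = k then b \<xi> $ i else A \<xi> $ i $ j) / det (A \<xi>))"
    if "\<xi> \<in> space M" for \<xi>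
  proof -
    have "det (A \<xi>) \<noteq> 0"
      using inj[OF that] by (simp flip: invertible_det_nz add: invertible_left_inverse matrix_left_invertible_ker)
    then show ?thesis using y[OF that] by (rule iffD1[OF cramer])
  qed
  have "(\<lambda>\<xi>. \<chi> k. det (\<chi> i j. if j = k then b \<xi> $ i else A \<xi> $ i $ j) / det (A \<xi>))
      \<in> borel_measurable M"
    unfolding borel_measurable_vec_iff
    using A b
    by (auto intro!: borel_measurable_divide borel_measurable_det measurable_If
        simp: borel_measurable_vec_iff)
  then show ?thesis using sol by (simp cong: measurable_cong)
qed

section \<open>Orthogonal splitting into the null space and the range of the transpose\<close>

lemma transpose_mult_inner:
  fixes A :: "real^'n^'m"
  shows "(transpose A *v s) \<bullet> z = s \<bullet> (A *v z)"
  by (simp add: dot_lmul_matrix)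

text \<open>The orthogonal complement of the range of \<open>transpose A\<close> lies in the null
  space of \<open>A\<close>: for \<open>z\<close> in it, testing against
  \<open>transpose A *v (A *v z)\<close> gives
  \<open>(A *v z) \<bullet> (A *v z) = 0\<close>.\<close>

lemma null_range_decomposition:
  fixes A :: "real^'n^'m"
  obtains a s where "x = a + transpose A *v s" "A *v a = 0"
proof -
  have S: "subspace (range ((*v) (transpose A)))"
    by (intro linear_subspace_image) auto
  obtain y z where yz: "y \<in> span (range ((*v) (transpose A)))"
      "\<And>w. w \<in> span (range ((*v) (transpose A))) \<Longrightarrow> orthogonal z w" "x = y + z"
    by (rule orthogonal_subspace_decomp_exists[of "range ((*v) (transpose A))" x]) blast
  have "y \<in> range ((*v) (transpose A))" using yz(1) S by (simp only: span_eq_iff[THEN iffD2])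
  then obtain s where s: "y = transpose A *v s" by (rule rangeE)
  have "orthogonal z (transpose A *v (A *v z))" by (rule yz(2)) (intro span_base, auto)
  then have "A *v z = 0"
    by (simp add: orthogonal_def inner_commute[of z] transpose_mult_inner del: transpose_matrix_vector)
  with yz(3) s that[of z s] show ?thesis by (simp only: add.commute)
qed

text \<open>A pointwise choice of null-space components is automatically linear, because the
  component is unique: the defect of additivity or homogeneity lies in the null space and is
  orthogonal to it. The matrix of this map is the orthogonal projection.\<close>

lemma null_projection_exists:
  fixes A :: "real^'n^'m"
  shows "\<exists>P. \<forall>x. A *v (P *v x) = 0 \<and> (\<exists>s. x = P *v x + transpose A *v s)"
proof -
  have "\<forall>x. \<exists>a. A *v a = 0 \<and> (\<exists>s. x = a + transpose A *v s)"
    by (metis null_range_decomposition)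
  then obtain p where p: "\<And>x. A *v p x = 0" "\<And>x. \<exists>s. x = p x + transpose A *v s" by metis
  have orth: "z \<bullet> (x - p x) = 0" if "A *v z = 0" for x z
  proof -
    obtain s where s: "x = p x + transpose A *v s" using p(2) by blast
    then have "x - p x = transpose A *v s" by (metis add_diff_cancel_left')
    then have "z \<bullet> (x - p x) = s \<bullet> (A *v z)" by (metis inner_commute transpose_mult_inner)
    then show ?thesis using that by simp
  qed
  have eqI: "a = 0" if "A *v a = 0" "\<And>z. A *v z = 0 \<Longrightarrow> z \<bullet> a = 0" for a
    using that(2)[OF that(1)] by simp
  have "p (x + y) - (p x + p y) = 0" for x y
  proof (rule eqI)
    show "A *v (p (x + y) - (p x + p y)) = 0"
      by (simp add: matrix_vector_mult_diff_distrib matrix_vector_right_distrib p)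
    fix z assume "A *v z = 0"
    from orth[OF this, of "x + y"] orth[OF this, of x] orth[OF this, of y]
    show "z \<bullet> (p (x + y) - (p x + p y)) = 0" by (simp add: algebra_simps)
  qed
  moreover have "p (r *\<^sub>R x) - r *\<^sub>R p x = 0" for r x
  proof (rule eqI)
    show "A *v (p (r *\<^sub>R x) - r *\<^sub>R p x) = 0"
      by (simp add: matrix_vector_mult_diff_distrib matrix_vector_mult_scaleR p)
    fix z assume "A *v z = 0"
    from orth[OF this, of "r *\<^sub>R x"] orth[OF this, of x]
    show "z \<bullet> (p (r *\<^sub>R x) - r *\<^sub>R p x) = 0" by (simp add: algebra_simps)
  qed
  ultimately have "linear p" by (intro linearI) auto
  then have "matrix p *v x = p x" for x by (simp add: matrix_works linear_matrix_vector_mul_eq)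
  then show ?thesis using p by metis
qed

text \<open>The projection onto the null space is the limit of the resolvents
  \<open>(I + n A\<^sup>T A)\<^sup>-\<^sup>1\<close>, whose values depend measurably on \<open>A\<close> by Cramer's rule.\<close>
lemma borel_measurable_null_projection:
  fixes A :: "'w \<Rightarrow> real^'n^'m"
  assumes A: "A \<in> borel_measurable M" and b: "b \<in> borel_measurable M"
    and p: "\<And>\<xi>. \<xi> \<in> space M \<Longrightarrow> A \<xi> *v p \<xi> = 0"
    and r: "\<And>\<xi>. \<xi> \<in> space M \<Longrightarrow> \<exists>s. b \<xi> = p \<xi> + transpose (A \<xi>) *v s"
  shows "p \<in> borel_measurable M"
proof -
  define B where "B n \<xi> = mat 1 + real n *\<^sub>R (transpose (A \<xi>) ** A \<xi>)" for n \<xi>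
  have B_mult: "B n \<xi> *v z = z + real n *\<^sub>R (transpose (A \<xi>) *v (A \<xi> *v z))" for n \<xi> z
    unfolding B_def
    by (simp add: matrix_vector_mult_add_rdistrib scaleR_matrix_vector_assoc[symmetric] matrix_vector_mul_assoc
        del: transpose_matrix_vector)
  have quad: "(B n \<xi> *v z) \<bullet> z = (norm z)^2 + real n * (norm (A \<xi> *v z))^2" for n \<xi> z
    by (simp add: B_mult inner_add_left transpose_mult_inner power2_norm_eq_inner
        del: transpose_matrix_vector)
  have inj: "z = 0" if "B n \<xi> *v z = 0" for n \<xi> z
  proof -
    have "(norm z)^2 + real n * (norm (A \<xi> *v z))^2 = 0" using quad[of n \<xi> z] that by simp
    moreover have "real n * (norm (A \<xi> *v z))^2 \<ge> 0" by simp
    ultimately have "(norm z)^2 \<le> 0" by linarith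
    then show ?thesis by simp
  qed
  have "\<exists>y. B n \<xi> *v y = b \<xi>" for n \<xi>
  proof -
    have "invertible (B n \<xi>)"
      using inj by (auto simp: invertible_left_inverse matrix_left_invertible_ker)
    then obtain C where "B n \<xi> ** C = mat 1" by (auto simp: invertible_right_inverse)
    then have "B n \<xi> *v (C *v b \<xi>) = b \<xi>" by (simp add: matrix_vector_mul_assoc)
    then show ?thesis by blast
  qed
  then obtain y where y: "\<And>n \<xi>. B n \<xi> *v y n \<xi> = b \<xi>" by metis
  have "y n \<in> borel_measurable M" for n
  proof (rule borel_measurable_linear_solution[OF _ b inj y])
    show "B n \<in> borel_measurable M"
      unfolding B_def using A
      by (intro borel_measurable_add borel_measurable_scaleR borel_measurable_matrix_mult
          borel_measurable_transpose) auto
  qed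
  moreover have "(\<lambda>n. y n \<xi>) \<longlonglongrightarrow> p \<xi>" if \<xi>: "\<xi> \<in> space M" for \<xi>
  proof -
    obtain s where s: "b \<xi> = p \<xi> + transpose (A \<xi>) *v s" using r[OF \<xi>] by blast
    \<comment> \<open>Since \<open>B n \<xi>\<close> fixes the null vector \<open>p \<xi>\<close>,
      the error \<open>e\<close> solves the resolvent system with right-hand side
      \<open>transpose (A \<xi>) *v s\<close>. Testing this system with \<open>e\<close> gives decay
      of order \<open>1 / n\<close>.\<close>
    have bound: "(norm (y n \<xi> - p \<xi>))^2 \<le> (norm s)^2 * inverse (real n)" if n: "n > 0" for n
    proof -
      define e where "e = y n \<xi> - p \<xi>"
      define t where "t = norm (A \<xi> *v e)"
      have "B n \<xi> *v e = transpose (A \<xi>) *v s"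
        unfolding e_def matrix_vector_mult_diff_distrib y s
        using p[OF \<xi>] by (simp add: B_mult)
      then have "(norm e)^2 + real n * t^2 = s \<bullet> (A \<xi> *v e)"
        using quad[of n \<xi> e] transpose_mult_inner[of "A \<xi>" s e] by (simp add: t_def)
      also have "\<dots> \<le> norm s * t" unfolding t_def by (rule norm_cauchy_schwarz)
      also have "\<dots> \<le> real n * t^2 + (norm s)^2 * inverse (real n)"
      proof -
        \<comment> \<open>A completed square; the spare term \<open>real n * t * norm s\<close> is
          nonnegative.\<close>
        have "0 \<le> ((real n * t - norm s)^2 + real n * t * norm s) / real n" by (simp add: t_def)
        also have "\<dots> = real n * t^2 + (norm s)^2 * inverse (real n) - norm s * t"
          using n by (simp add: field_simps power2_eq_square)
        finally show ?thesis by simp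
      qed
      finally show ?thesis by (simp add: e_def)
    qed
    have "(\<lambda>n. (norm s)^2 * inverse (real n)) \<longlonglongrightarrow> 0"
      by (intro tendsto_mult_right_zero lim_inverse_n)
    then have "(\<lambda>n. (norm (y n \<xi> - p \<xi>))^2) \<longlonglongrightarrow> 0"
      by (rule Lim_null_comparison[rotated])
         (use bound in \<open>auto simp: eventually_sequentially intro!: exI[of _ 1]\<close>)
    then have "(\<lambda>n. sqrt ((norm (y n \<xi> - p \<xi>))^2)) \<longlonglongrightarrow> sqrt 0" by (rule tendsto_real_sqrt)
    then show ?thesis by (simp add: tendsto_norm_zero_iff LIM_zero_iff)
  qed
  ultimately show ?thesis by (rule borel_measurable_LIMSEQ_metric)
qed

section \<open>The quadratic subproblem as a linear system on the null space\<close>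

text \<open>First-order optimality in variational form: testing only with null vectors eliminates
  the Lagrange multiplier. The free right-hand side \<open>y\<close> lets one predicate cover the
  step, its exact counterpart, their difference and the dual vector.\<close>

definition reduced_solution :: "real^'n^'m \<Rightarrow> real^'n^'n \<Rightarrow> real^'n \<Rightarrow> real^'n \<Rightarrow> bool" where
  "reduced_solution J H y w \<longleftrightarrow>
     J *v w = 0 \<and> (\<forall>z. J *v z = 0 \<longrightarrow> z \<bullet> (H *v w) = z \<bullet> y)"

lemma reduced_solution_diff:
  assumes "reduced_solution J H y w" "reduced_solution J H y' w'"
  shows "reduced_solution J H (y - y') (w - w')"
  using assms unfolding reduced_solution_def
  by (simp add: matrix_vector_mult_diff_distrib inner_diff_right)

text \<open>Coercivity, with \<open>w\<close> itself as test vector. Applied to a difference of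
  solutions this gives uniqueness, and also the bound of the step error by the gradient
  noise.\<close>

lemma reduced_solution_norm_le:
  assumes "reduced_solution J H y w"
    and \<zeta>: "\<zeta> > 0" "\<And>z. J *v z = 0 \<Longrightarrow> z \<bullet> (H *v z) \<ge> \<zeta> * (norm z)^2"
  shows "norm w \<le> inverse \<zeta> * norm y"
proof -
  have "\<zeta> * (norm w)^2 \<le> w \<bullet> y" using assms unfolding reduced_solution_def by metis
  also have "\<dots> \<le> norm w * norm y" by (rule norm_cauchy_schwarz)
  finally have "norm w * (\<zeta> * norm w) \<le> norm w * norm y" by (simp add: power2_eq_square mult_ac)
  then have "\<zeta> * norm w \<le> norm y"
    by (cases "norm w = 0") auto
  then show ?thesis using \<zeta>(1) by (simp add: field_simps)
qed

lemma reduced_solution_unique: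
  assumes "reduced_solution J H y w" "reduced_solution J H y w'"
    and \<zeta>: "\<zeta> > 0" "\<And>z. J *v z = 0 \<Longrightarrow> z \<bullet> (H *v z) \<ge> \<zeta> * (norm z)^2"
  shows "w = w'"
  using reduced_solution_norm_le[OF reduced_solution_diff[OF assms(1,2)] \<zeta>] by simp

lemma symmetric_matrix_inner:
  fixes H :: "real^'n^'n"
  assumes "transpose H = H"
  shows "x \<bullet> (H *v y) = y \<bullet> (H *v x)"
  by (metis assms inner_commute transpose_mult_inner)

text \<open>Along each line \<open>u + t *\<^sub>R z\<close> in the null space, minimality gives a
  quadratic in \<open>t\<close> that is nonnegative and vanishes at 0, so its linear coefficient is
  zero. Symmetry of \<open>H\<close> merges the two mixed terms.\<close>

lemma tangential_step_reduced_solution: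
  assumes min: "tangential_step g H v J u" and sym: "transpose H = H"
    and psd: "\<And>z. J *v z = 0 \<Longrightarrow> z \<bullet> (H *v z) \<ge> 0"
  shows "reduced_solution J H (- (g + H *v v)) u"
  unfolding reduced_solution_def
proof (intro conjI allI impI)
  let ?q = "g + H *v v"
  define Q where "Q w = ?q \<bullet> w + (1/2) * (w \<bullet> (H *v w))" for w
  show Ju: "J *v u = 0" using min by (simp add: tangential_step_def is_arg_min_def)
  fix z assume z: "J *v z = 0"
  define s where "s = z \<bullet> (?q + H *v u)"
  define a where "a = z \<bullet> (H *v z)"
  have a: "a \<ge> 0" using psd[OF z] by (simp add: a_def)
  have le: "0 \<le> t * s + t^2 / 2 * a" for t
  proof -
    have "J *v (u + t *\<^sub>R z) = 0"
      using Ju z by (simp add: matrix_vector_right_distrib matrix_vector_mult_scaleR)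
    then have "Q u \<le> Q (u + t *\<^sub>R z)"
      using min by (auto simp: tangential_step_def is_arg_min_linorder Q_def)
    also have "\<dots> = Q u + (t * s + t^2 / 2 * a)"
      using symmetric_matrix_inner[OF sym, of u z]
      by (simp add: Q_def s_def a_def matrix_vector_right_distrib matrix_vector_mult_scaleR
          inner_add_left inner_add_right inner_commute[of z g] inner_commute[of z "H *v v"]
          power2_eq_square algebra_simps)
    finally show ?thesis by simp
  qed
  \<comment> \<open>At \<open>t = - r\<close> the quadratic equals
    \<open>- r^2 * (a + 2) / 2\<close>. The shift by 1 keeps the denominator positive when
    \<open>a = 0\<close>.\<close>
  define r where "r = s / (a + 1)"
  have s: "s = r * (a + 1)" using a by (simp add: r_def)
  have "r^2 * (a + 2) \<le> 0"
    using le[of "- r"] by (simp add: s power2_eq_square algebra_simps)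
  then have "r = 0" using a by (simp add: mult_le_0_iff)
  then have "s = 0" by (simp add: s)
  then show "z \<bullet> (H *v u) = z \<bullet> - ?q" by (simp add: s_def inner_add_right inner_diff_right)
qed

text \<open>With \<open>P\<close> the projection onto the null space of \<open>J\<close>, the solution solves the
  nonsingular linear system \<open>(P H P + I - P) w = P y\<close>.\<close>
lemma borel_measurable_reduced_solution:
  fixes J :: "'w \<Rightarrow> real^'n^'m"
  assumes J: "J \<in> borel_measurable F" and H: "H \<in> borel_measurable F"
    and y: "y \<in> borel_measurable F"
    and pd: "\<And>\<xi> z. \<xi> \<in> space F \<Longrightarrow> J \<xi> *v z = 0 \<Longrightarrow> z \<noteq> 0 \<Longrightarrow> z \<bullet> (H \<xi> *v z) > 0"
  shows "\<exists>w\<in>borel_measurable F. \<forall>\<xi>\<in>space F. reduced_solution (J \<xi>) (H \<xi>) (y \<xi>) (w \<xi>)"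
proof -
  have "\<forall>\<xi>. \<exists>P. \<forall>x. J \<xi> *v (P *v x) = 0 \<and> (\<exists>s. x = P *v x + transpose (J \<xi>) *v s)"
    by (intro allI null_projection_exists)
  from choice[OF this] obtain P where "\<forall>\<xi> x. J \<xi> *v (P \<xi> *v x) = 0 \<and>
      (\<exists>s. x = P \<xi> *v x + transpose (J \<xi>) *v s)" ..
  then have JP: "\<And>\<xi> x. J \<xi> *v (P \<xi> *v x) = 0"
    and P: "\<And>\<xi> x. \<exists>s. x = P \<xi> *v x + transpose (J \<xi>) *v s"
    by blast+
  have orth: "z \<bullet> (P \<xi> *v x) = z \<bullet> x" if "J \<xi> *v z = 0" for \<xi> x z
  proof -
    obtain s where s: "x = P \<xi> *v x + transpose (J \<xi>) *v s" using P by blast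
    have "z \<bullet> (transpose (J \<xi>) *v s) = 0"
      by (metis inner_commute transpose_mult_inner that inner_zero_right)
    then show ?thesis using arg_cong[OF s, of "\<lambda>x. z \<bullet> x"] by (simp only: inner_add_right)
  qed
  have P_meas: "P \<in> borel_measurable F"
  proof -
    have "(\<lambda>\<xi>. P \<xi> *v axis j 1) \<in> borel_measurable F" for j
      by (rule borel_measurable_null_projection[OF J borel_measurable_const JP P])
    then show ?thesis
      unfolding borel_measurable_matrix_iff
      by (simp add: matrix_vector_mult_basis borel_measurable_vec_iff column_def)
  qed
  define N where "N \<xi> = P \<xi> ** H \<xi> ** P \<xi> + (mat 1 - P \<xi>)" for \<xi>
  have N: "N \<xi> *v z = P \<xi> *v (H \<xi> *v (P \<xi> *v z)) + (z - P \<xi> *v z)" for \<xi> z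
    by (simp add: N_def matrix_vector_mult_add_rdistrib matrix_vector_mult_diff_rdistrib
        matrix_vector_mul_assoc matrix_mul_assoc)
  \<comment> \<open>Testing with \<open>a = P \<xi> *v z\<close> leaves only the curvature of
    \<open>a\<close>, because \<open>z - a\<close> is orthogonal to the null space. Hence
    \<open>a = 0\<close>, and then \<open>N \<xi> *v z\<close> is just \<open>z\<close>.\<close>
  have inj: "z = 0" if \<xi>: "\<xi> \<in> space F" and "N \<xi> *v z = 0" for \<xi> z
  proof -
    define a where "a = P \<xi> *v z"
    have "a \<bullet> (N \<xi> *v z) = a \<bullet> (H \<xi> *v a)"
      using orth[OF JP, of \<xi> z] by (simp add: N inner_add_right inner_diff_right a_def)
    then have "a = 0" using that pd[OF \<xi> JP, of z] by (metis a_def inner_zero_right less_irrefl)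
    then show ?thesis using that N[of \<xi> z] by (simp add: a_def)
  qed
  have "\<exists>w. N \<xi> *v w = P \<xi> *v y \<xi>" if \<xi>: "\<xi> \<in> space F" for \<xi>
  proof -
    have "invertible (N \<xi>)"
      using inj[OF \<xi>] by (auto simp: invertible_left_inverse matrix_left_invertible_ker)
    then obtain C where "N \<xi> ** C = mat 1" by (auto simp: invertible_right_inverse)
    then have "N \<xi> *v (C *v (P \<xi> *v y \<xi>)) = P \<xi> *v y \<xi>" by (simp add: matrix_vector_mul_assoc matrix_mul_assoc)
    then show ?thesis by blast
  qed
  then obtain w where w: "\<And>\<xi>. \<xi> \<in> space F \<Longrightarrow> N \<xi> *v w \<xi> = P \<xi> *v y \<xi>" by metis
  have "w \<in> borel_measurable F"
  proof (rule borel_measurable_linear_solution[OF _ _ inj w])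
    show "N \<in> borel_measurable F"
      unfolding N_def using H P_meas
      by (intro borel_measurable_add borel_measurable_diff borel_measurable_matrix_mult) auto
    show "(\<lambda>\<xi>. P \<xi> *v y \<xi>) \<in> borel_measurable F"
      by (rule borel_measurable_matrix_vector_mult[OF P_meas y])
  qed
  moreover have "reduced_solution (J \<xi>) (H \<xi>) (y \<xi>) (w \<xi>)" if \<xi>: "\<xi> \<in> space F" for \<xi>
  proof -
    let ?a = "P \<xi> *v w \<xi>"
    have eq: "P \<xi> *v (H \<xi> *v ?a) + (w \<xi> - ?a) = P \<xi> *v y \<xi>" using w[OF \<xi>] by (simp only: N)
    \<comment> \<open>Every term on the right is a projected vector, so \<open>w \<xi>\<close> lies
      in the null space. There \<open>P \<xi>\<close> acts as the identity, and the system becomes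
      the variational one.\<close>
    then have "w \<xi> = P \<xi> *v y \<xi> - P \<xi> *v (H \<xi> *v ?a) + ?a"
      by (simp add: algebra_simps)
    then have Jw: "J \<xi> *v w \<xi> = 0"
      by (metis JP matrix_vector_right_distrib matrix_vector_mult_diff_distrib diff_zero add_0)
    then have "J \<xi> *v (w \<xi> - ?a) = 0" by (simp add: matrix_vector_mult_diff_distrib JP)
    then have "(w \<xi> - ?a) \<bullet> (w \<xi> - ?a) = 0" using orth[of \<xi> "w \<xi> - ?a" "w \<xi>"] by (simp add: inner_diff_right)
    then have Pw: "?a = w \<xi>" by simp
    have "z \<bullet> (H \<xi> *v w \<xi>) = z \<bullet> y \<xi>" if "J \<xi> *v z = 0" for z
      using arg_cong[OF eq, of "\<lambda>x. z \<bullet> x"] orth[OF that] Pw by simp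
    then show ?thesis using Jw by (simp add: reduced_solution_def)
  qed
  ultimately show ?thesis by blast
qed

section \<open>Taylor remainders and operator norm bounds\<close>

text \<open>Monotonicity of a scalar function replaces integration: the Taylor error along the
  segment is paired with the final remainder \<open>r\<close>, and the term in
  \<open>t^2 / 2\<close> dominates its growth by the Lipschitz bound. The inner product treats the
  real \<open>f\<close> and the vector-valued \<open>c\<close> alike.\<close>

lemma norm_taylor_bound:
  fixes F :: "'a::real_normed_vector \<Rightarrow> 'b::real_inner"
  assumes X: "convex X" "x \<in> X" "y \<in> X"
    and F: "\<And>z. z \<in> X \<Longrightarrow> (F has_derivative F' z) (at z)"
    and lip: "\<And>z z' h. z \<in> X \<Longrightarrow> z' \<in> X \<Longrightarrow> norm (F' z h - F' z' h) \<le> C * norm (z - z') * norm h"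
  shows "norm (F y - F x - F' x (y - x)) \<le> C / 2 * (norm (y - x))^2"
proof -
  define s where "s = y - x"
  define r where "r = F y - F x - F' x s"
  define h where "h t = r \<bullet> (F (x + t *\<^sub>R s) - F x - t *\<^sub>R F' x s) - norm r * C * t^2 / 2 * (norm s)^2" for t
  have "h 1 \<le> h 0"
  proof (rule DERIV_nonpos_imp_nonincreasing[of 0 1 h])
    fix t :: real assume t: "0 \<le> t" "t \<le> 1"
    have inX: "x + t *\<^sub>R s \<in> X"
    proof -
      have "(1 - t) *\<^sub>R x + t *\<^sub>R y \<in> X" using X t by (simp add: convex_alt)
      then show ?thesis by (simp add: s_def algebra_simps)
    qed
    have "((\<lambda>t. x + t *\<^sub>R s) has_derivative (\<lambda>u. u *\<^sub>R s)) (at t)"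
      by (auto intro!: derivative_eq_intros)
    then have "((\<lambda>t. F (x + t *\<^sub>R s)) has_derivative (\<lambda>u. F' (x + t *\<^sub>R s) (u *\<^sub>R s))) (at t)"
      by (rule has_derivative_compose) (rule F[OF inX])
    moreover have "F' (x + t *\<^sub>R s) (u *\<^sub>R s) = u *\<^sub>R F' (x + t *\<^sub>R s) s" for u
      using has_derivative_linear[OF F[OF inX]] by (rule linear_cmul)
    ultimately have "((\<lambda>t. F (x + t *\<^sub>R s)) has_vector_derivative F' (x + t *\<^sub>R s) s) (at t)"
      by (simp add: has_vector_derivative_def)
    then have "((\<lambda>t. F (x + t *\<^sub>R s) - F x - t *\<^sub>R F' x s) has_vector_derivative
         (F' (x + t *\<^sub>R s) s - F' x s)) (at t)"
      by (auto intro!: derivative_eq_intros)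
    then have "((\<lambda>t. r \<bullet> (F (x + t *\<^sub>R s) - F x - t *\<^sub>R F' x s)) has_vector_derivative
         r \<bullet> (F' (x + t *\<^sub>R s) s - F' x s)) (at t)"
      by (rule bounded_linear.has_vector_derivative[OF bounded_linear_inner_right])
    then have "(h has_real_derivative
        r \<bullet> (F' (x + t *\<^sub>R s) s - F' x s) - norm r * C * t * (norm s)^2) (at t)"
      unfolding h_def has_real_derivative_iff_has_vector_derivative
      by (rule has_vector_derivative_diff)
         (auto intro!: derivative_eq_intros simp: has_real_derivative_iff_has_vector_derivative[symmetric])
    moreover have "r \<bullet> (F' (x + t *\<^sub>R s) s - F' x s) \<le> norm r * C * t * (norm s)^2"
    proof -
      have "r \<bullet> (F' (x + t *\<^sub>R s) s - F' x s) \<le> norm r * norm (F' (x + t *\<^sub>R s) s - F' x s)"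
        by (rule norm_cauchy_schwarz)
      also have "\<dots> \<le> norm r * (C * norm (x + t *\<^sub>R s - x) * norm s)"
        by (intro mult_left_mono lip inX X) auto
      finally show ?thesis using t by (simp add: power2_eq_square mult_ac)
    qed
    ultimately show "\<exists>l. (h has_real_derivative l) (at t) \<and> l \<le> 0" by force
  qed simp
  moreover have "h 0 = 0" by (simp add: h_def)
  moreover have "h 1 = norm r * norm r - norm r * C / 2 * (norm s)^2"
    by (simp add: h_def r_def[symmetric] s_def flip: power2_norm_eq_inner)
       (simp add: r_def s_def power2_norm_eq_inner[symmetric] power2_eq_square)
  ultimately have "norm r * norm r \<le> norm r * (C / 2 * (norm s)^2)" by simp
  \<comment> \<open>This sign settles the case \<open>norm r = 0\<close>, where
    \<open>norm r\<close> cannot be cancelled.\<close>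
  moreover have "C / 2 * (norm s)^2 \<ge> 0"
    using lip[of y x s] X by (metis s_def norm_ge_zero order_trans power2_eq_square mult.assoc
        zero_le_divide_iff zero_le_numeral times_divide_eq_left)
  ultimately show ?thesis
    by (cases "norm r = 0") (auto simp: r_def s_def)
qed

lemma norm_matrix_vector_mult_le:
  fixes A :: "real^'n^'m"
  assumes "opnorm A \<le> B" "norm z \<le> r"
  shows "norm (A *v z) \<le> B * r"
proof -
  have "norm (A *v z) \<le> opnorm A * norm z" by (rule onorm) auto
  also have "\<dots> \<le> B * r"
    using assms onorm_pos_le[OF matrix_vector_mul_bounded_linear[of A]] by (intro mult_mono) auto
  finally show ?thesis .
qed

text \<open>By duality: for \<open>?y = transpose A *v s\<close> the square of
  \<open>norm ?y\<close> is \<open>s \<bullet> (A *v ?y)\<close>, and one factor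
  \<open>norm ?y\<close> cancels.\<close>

lemma norm_transpose_matrix_vector_mult_le:
  fixes A :: "real^'n^'m"
  assumes A: "opnorm A \<le> B" and s: "norm s \<le> r"
  shows "norm (transpose A *v s) \<le> B * r"
proof -
  let ?y = "transpose A *v s"
  have B: "0 \<le> B" using A onorm_pos_le[OF matrix_vector_mul_bounded_linear[of A]] by linarith
  have "norm ?y * norm ?y = s \<bullet> (A *v ?y)"
    by (metis power2_eq_square power2_norm_eq_inner transpose_mult_inner)
  also have "\<dots> \<le> norm s * norm (A *v ?y)" by (rule norm_cauchy_schwarz)
  also have "\<dots> \<le> r * (B * norm ?y)"
    using s norm_ge_zero[of s] by (intro mult_mono norm_matrix_vector_mult_le[OF A]) (linarith | simp)+
  finally have "norm ?y * norm ?y \<le> norm ?y * (B * r)" by (simp only: mult_ac)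
  moreover have "0 \<le> B * r" using B s norm_ge_zero[of s] by (intro mult_nonneg_nonneg) linarith+
  ultimately show ?thesis by (cases "norm ?y = 0") (simp_all del: transpose_matrix_vector)
qed

section \<open>Pointwise decrease of the merit function\<close>

text \<open>The linear model of \<open>c\<close> sees only \<open>v\<close>, as \<open>u\<close> is
  a null vector, and for \<open>\<alpha>\<close> in the unit interval it is a convex combination of
  \<open>c x\<close> and \<open>c x + J x *v v\<close>. The squared length of \<open>d\<close>
  splits by Pythagoras.\<close>

lemma merit_function_upper_bound:
  assumes smooth: "smoothness_assumption X f gradf c J L \<Gamma>"
    and x: "x \<in> X" "x + \<alpha> *\<^sub>R d \<in> X"
    and d: "d = \<beta> *\<^sub>R u + v" "J x *v u = 0" "v \<in> range (\<lambda>y. transpose (J x) *v y)"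
    and \<alpha>: "0 \<le> \<alpha>" "\<alpha> \<le> 1" and \<tau>: "0 \<le> \<tau>"
  shows "\<tau> * f (x + \<alpha> *\<^sub>R d) + norm (c (x + \<alpha> *\<^sub>R d)) \<le> \<tau> * f x + norm (c x)
    + \<alpha> * (\<tau> * (gradf x \<bullet> d) - (norm (c x) - norm (c x + J x *v v)))
    + (\<tau> * L + \<Gamma>) / 2 * (\<alpha>^2 * (\<beta>^2 * (norm u)^2 + (norm v)^2))"
proof -
  let ?y = "x + \<alpha> *\<^sub>R d"
  have X: "convex X" using smooth by (simp add: smoothness_assumption_def)
  have Jd: "J x *v d = J x *v v"
    by (simp add: d matrix_vector_right_distrib matrix_vector_mult_scaleR)
  have "norm (f ?y - f x - gradf x \<bullet> (?y - x)) \<le> L / 2 * (norm (?y - x))^2"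
  proof (rule norm_taylor_bound[OF X x, where F' = "\<lambda>x h. gradf x \<bullet> h"])
    show "(f has_derivative (\<lambda>h. gradf z \<bullet> h)) (at z)" if "z \<in> X" for z
      using smooth that by (auto simp: smoothness_assumption_def gderiv_def inner_commute)
    show "norm (gradf z \<bullet> h - gradf z' \<bullet> h) \<le> L * norm (z - z') * norm h"
      if "z \<in> X" "z' \<in> X" for z z' h
    proof -
      have "norm (gradf z \<bullet> h - gradf z' \<bullet> h) \<le> norm (gradf z - gradf z') * norm h"
        using Cauchy_Schwarz_ineq2[of "gradf z - gradf z'" h] by (simp add: inner_diff_left)
      also have "\<dots> \<le> L * norm (z - z') * norm h"
        using smooth that by (intro mult_right_mono) (auto simp: smoothness_assumption_def)
      finally show ?thesis .
    qed
  qed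
  then have "f ?y - f x - gradf x \<bullet> (?y - x) \<le> L / 2 * (norm (?y - x))^2"
    unfolding real_norm_def by (rule abs_le_D1)
  then have f: "f ?y \<le> f x + \<alpha> * (gradf x \<bullet> d) + L / 2 * (\<alpha>^2 * (norm d)^2)"
    using \<alpha> by (simp add: power_mult_distrib)
  have "norm (c ?y - c x - J x *v (?y - x)) \<le> \<Gamma> / 2 * (norm (?y - x))^2"
  proof (rule norm_taylor_bound[OF X x, where F' = "\<lambda>x h. J x *v h"])
    show "(c has_derivative (\<lambda>h. J z *v h)) (at z)" if "z \<in> X" for z
      using smooth that by (auto simp: smoothness_assumption_def)
    show "norm (J z *v h - J z' *v h) \<le> \<Gamma> * norm (z - z') * norm h"
      if "z \<in> X" "z' \<in> X" for z z' h
      unfolding matrix_vector_mult_diff_rdistrib[symmetric]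
      using smooth that
      by (intro norm_matrix_vector_mult_le) (auto simp: smoothness_assumption_def)
  qed
  then have c: "norm (c ?y - c x - \<alpha> *\<^sub>R (J x *v v)) \<le> \<Gamma> / 2 * (\<alpha>^2 * (norm d)^2)"
    using \<alpha> by (simp add: power_mult_distrib matrix_vector_mult_scaleR Jd)
  have "c ?y = (c ?y - c x - \<alpha> *\<^sub>R (J x *v v)) + ((1 - \<alpha>) *\<^sub>R c x + \<alpha> *\<^sub>R (c x + J x *v v))"
    by (simp add: algebra_simps)
  then have "norm (c ?y) \<le> norm (c ?y - c x - \<alpha> *\<^sub>R (J x *v v))
      + norm ((1 - \<alpha>) *\<^sub>R c x + \<alpha> *\<^sub>R (c x + J x *v v))"
    by (metis norm_triangle_ineq)
  also have "norm ((1 - \<alpha>) *\<^sub>R c x + \<alpha> *\<^sub>R (c x + J x *v v))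
      \<le> (1 - \<alpha>) * norm (c x) + \<alpha> * norm (c x + J x *v v)"
    by (rule norm_triangle_le) (use \<alpha> in simp)
  finally have c': "norm (c ?y) \<le> \<Gamma> / 2 * (\<alpha>^2 * (norm d)^2)
      + ((1 - \<alpha>) * norm (c x) + \<alpha> * norm (c x + J x *v v))"
    using c by simp
  have "(norm d)^2 = \<beta>^2 * (norm u)^2 + (norm v)^2"
  proof -
    obtain s where s: "v = transpose (J x) *v s" using d(3) by blast
    have "v \<bullet> u = 0" unfolding s transpose_mult_inner by (simp add: d(2))
    then show ?thesis
      unfolding d(1) power2_norm_eq_inner
      by (simp add: inner_add_left inner_add_right inner_commute power2_eq_square)
  qed
  then show ?thesis
    using mult_left_mono[OF f \<tau>] c' by (simp add: algebra_simps add_divide_distrib)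
qed

text \<open>Half of the guaranteed decrease pays for the part of the second-order term with
  \<open>\<nu>^2\<close>; the other half remains. The noise enters linearly through
  \<open>u - u'\<close>, with coefficients free of \<open>\<alpha>\<close>, and otherwise squared
  with the factor \<open>\<beta>^2\<close>. The bound on \<open>u'\<close> is exported because it
  later bounds the dual vector.\<close>

lemma merit_decrease_pointwise:
  assumes smooth: "smoothness_assumption X f gradf c J L \<Gamma>"
    and x: "x \<in> X" "x + \<alpha> *\<^sub>R d \<in> X"
    and bounds: "norm (gradf x) \<le> \<kappa>\<^sub>g" "0 < \<kappa>\<^sub>c" "norm (c x) \<le> \<kappa>\<^sub>c" "opnorm (J x) \<le> \<kappa>\<^sub>J"
    and H: "transpose H = H" "opnorm H \<le> \<kappa>\<^sub>H" "\<zeta> > 0"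
      "\<And>w. J x *v w = 0 \<Longrightarrow> w \<bullet> (H *v w) \<ge> \<zeta> * (norm w)^2"
    and v: "\<omega> > 0" "normal_step \<omega> \<epsilon> (c x) (J x) a v"
    and u: "tangential_step g H v (J x) u" and d: "d = \<beta> *\<^sub>R u + v"
    and u': "tangential_step (gradf x) H v (J x) u'" and d': "d' = \<beta> *\<^sub>R u' + v"
    and merit: "0 < \<sigma>" "0 < \<tau>" "\<tau> * (gradf x \<bullet> d' + \<beta> * (u' \<bullet> (H *v u')))
       \<le> (1 - \<sigma>) * (norm (c x) - norm (c x + J x *v v))"
    and kv: "\<kappa>\<^sub>v > 0" "\<kappa>\<^sub>v * (norm (transpose (J x) *v c x))^2
       \<le> norm (c x) * (norm (c x) - norm (c x + J x *v v))"
    and ku: "\<kappa>\<^sub>u = inverse \<zeta> * (\<kappa>\<^sub>g + \<kappa>\<^sub>H * \<omega> * \<kappa>\<^sub>J * \<kappa>\<^sub>c)"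
    and \<alpha>: "\<nu> > 0" "\<nu> \<le> \<alpha>" "\<alpha> \<le> \<nu> + \<theta> * \<beta>" "\<alpha> \<le> 1" "\<beta> > 0" "\<theta> > 0"
    and \<nu>: "\<nu> \<le> \<sigma> * \<kappa>\<^sub>v * inverse \<kappa>\<^sub>c / (2 * (\<tau> * L + \<Gamma>) * \<omega>^2)"
    and M: "M > 0"
  shows "norm u' \<le> \<kappa>\<^sub>u"
    and "\<tau> * f (x + \<alpha> *\<^sub>R d) + norm (c (x + \<alpha> *\<^sub>R d)) \<le> \<tau> * f x + norm (c x)
      - \<nu> * \<sigma> * \<kappa>\<^sub>v * inverse \<kappa>\<^sub>c / 2 * (norm (transpose (J x) *v c x))^2
      + ((\<nu> * \<tau> * \<beta>) *\<^sub>R gradf x + ((\<tau> * L + \<Gamma>) * \<beta>^2) *\<^sub>R u') \<bullet> (u - u')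
      + \<beta>^2 * (1/2 * (\<tau> * L + \<Gamma>)
            * (inverse \<zeta> * \<kappa>\<^sub>H * \<kappa>\<^sub>u^2 + (inverse \<zeta>)^2 * (norm (g - gradf x))^2)
          + \<theta> * \<kappa>\<^sub>g * \<tau> * inverse \<zeta> * ((sqrt M + (norm (g - gradf x))^2 / sqrt M) / 2)
          + \<theta>^2 * (\<tau> * L + \<Gamma>) * \<omega>^2 * \<kappa>\<^sub>J^2 * \<kappa>\<^sub>c^2)"
proof -
  define A where "A = \<tau> * L + \<Gamma>"
  define \<Delta> where "\<Delta> = norm (c x) - norm (c x + J x *v v)"
  define R where "R = (norm (transpose (J x) *v c x))^2"
  define \<delta> where "\<delta> = g - gradf x"
  define e where "e = u - u'"
  have A: "A > 0"
    using smooth merit by (auto simp: A_def smoothness_assumption_def intro!: add_pos_pos)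
  have \<kappa>0: "0 \<le> \<kappa>\<^sub>g" "0 \<le> \<kappa>\<^sub>J" "0 \<le> \<kappa>\<^sub>H"
    using bounds H norm_ge_zero[of "gradf x"] onorm_pos_le[OF matrix_vector_mul_bounded_linear[of H]]
      onorm_pos_le[OF matrix_vector_mul_bounded_linear[of "J x"]] by linarith+
  have psd: "0 \<le> z \<bullet> (H *v z)" if "J x *v z = 0" for z
    using H(3) by (intro order_trans[OF _ H(4)[OF that]]) simp
  have ru: "reduced_solution (J x) H (- (g + H *v v)) u"
    and ru': "reduced_solution (J x) H (- (gradf x + H *v v)) u'"
    using u u' H(1) psd by (blast intro: tangential_step_reduced_solution)+
  have Ju: "J x *v u = 0" and Ju': "J x *v u' = 0"
    using ru ru' by (auto simp: reduced_solution_def)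
  have v_range: "v \<in> range (\<lambda>y. transpose (J x) *v y)"
    and v_le: "norm v \<le> \<omega> * norm (transpose (J x) *v c x)"
    using v by (auto simp: normal_step_def)
  have Jc: "norm (transpose (J x) *v c x) \<le> \<kappa>\<^sub>J * \<kappa>\<^sub>c"
    by (rule norm_transpose_matrix_vector_mult_le[OF bounds(4,3)])
  have R: "0 \<le> R" "R \<le> \<kappa>\<^sub>J^2 * \<kappa>\<^sub>c^2"
    using power_mono[OF Jc, of 2] by (simp_all add: R_def power_mult_distrib)
  have v_sq: "(norm v)^2 \<le> \<omega>^2 * R"
    using power_mono[OF v_le, of 2] by (simp add: R_def power_mult_distrib)
  have "norm v \<le> \<omega> * (\<kappa>\<^sub>J * \<kappa>\<^sub>c)"
    using v_le mult_left_mono[OF Jc, of \<omega>] v(1) by linarith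
  then have "norm (H *v v) \<le> \<kappa>\<^sub>H * (\<omega> * (\<kappa>\<^sub>J * \<kappa>\<^sub>c))"
    by (rule norm_matrix_vector_mult_le[OF H(2)])
  then have "norm (- (gradf x + H *v v)) \<le> \<kappa>\<^sub>g + \<kappa>\<^sub>H * \<omega> * \<kappa>\<^sub>J * \<kappa>\<^sub>c"
    unfolding norm_minus_cancel mult.assoc
    using bounds(1) norm_triangle_ineq[of "gradf x" "H *v v"] by linarith
  then have "inverse \<zeta> * norm (- (gradf x + H *v v)) \<le> \<kappa>\<^sub>u"
    unfolding ku using H(3) by (intro mult_left_mono) auto
  with reduced_solution_norm_le[OF ru' H(3,4)] show u'_le: "norm u' \<le> \<kappa>\<^sub>u" by simp
  \<comment> \<open>Passing through the curvature of \<open>H\<close> produces the factor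
    \<open>inverse \<zeta> * \<kappa>\<^sub>H\<close> of \<open>\<kappa>\<^sub>1\<close>.\<close>
  have u'_sq: "(norm u')^2 \<le> inverse \<zeta> * \<kappa>\<^sub>H * \<kappa>\<^sub>u^2"
  proof -
    have "\<zeta> * (norm u')^2 \<le> u' \<bullet> (H *v u')" by (rule H(4)[OF Ju'])
    also have "\<dots> \<le> norm u' * norm (H *v u')" by (rule norm_cauchy_schwarz)
    also have "\<dots> \<le> norm u' * (\<kappa>\<^sub>H * norm u')"
      by (intro mult_left_mono norm_matrix_vector_mult_le H) auto
    also have "\<dots> = \<kappa>\<^sub>H * (norm u')^2" by (simp add: power2_eq_square)
    also have "\<dots> \<le> \<kappa>\<^sub>H * \<kappa>\<^sub>u^2" using u'_le \<kappa>0 by (intro mult_left_mono power_mono) auto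
    finally show ?thesis using H(3) by (simp add: field_simps)
  qed
  have e_le: "norm e \<le> inverse \<zeta> * norm \<delta>"
    using reduced_solution_norm_le[OF reduced_solution_diff[OF ru ru'] H(3,4)]
    by (simp add: e_def \<delta>_def norm_minus_commute)
  have e_sq: "(norm e)^2 \<le> (inverse \<zeta>)^2 * (norm \<delta>)^2"
    using power_mono[OF e_le, of 2] by (simp add: power_mult_distrib)
  have am_gm: "r \<le> (q + r^2 / q) / 2" if "q > 0" for q r :: real
  proof -
    have "0 \<le> (q - r)^2 / q" using that by simp
    also have "\<dots> = q + r^2 / q - 2 * r"
      using that by (simp add: field_simps power2_eq_square)
    finally show ?thesis by simp
  qed
  \<comment> \<open>This trades the first power of the noise for its square. The weight
    \<open>sqrt M\<close> is chosen so that a second moment of at most \<open>M\<close> turns the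
    right-hand side into at most \<open>sqrt M\<close>.\<close>
  have amgm: "norm \<delta> \<le> (sqrt M + (norm \<delta>)^2 / sqrt M) / 2"
    using M by (intro am_gm) simp
  \<comment> \<open>For \<open>c x = 0\<close> the hypothesis on \<open>\<kappa>\<^sub>v\<close>
    gives no sign, but the length bound of the normal step forces \<open>v = 0\<close>.\<close>
  have \<Delta>: "0 \<le> \<Delta>"
  proof (cases "c x = 0")
    case True
    then have "v = 0" using v_le by simp
    then show ?thesis by (simp add: \<Delta>_def)
  next
    case False
    have "0 \<le> norm (c x) * \<Delta>"
      using kv by (intro order_trans[OF _ kv(2)[folded \<Delta>_def]]) simp
    then show ?thesis using False by (simp add: zero_le_mult_iff)
  qed
  have \<Delta>_ge: "\<kappa>\<^sub>v * inverse \<kappa>\<^sub>c * R \<le> \<Delta>"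
  proof -
    have "\<kappa>\<^sub>v * R \<le> norm (c x) * \<Delta>" using kv(2) by (simp add: R_def \<Delta>_def)
    also have "\<dots> \<le> \<kappa>\<^sub>c * \<Delta>" using bounds \<Delta> by (intro mult_right_mono) auto
    finally show ?thesis using bounds(2) by (simp add: field_simps)
  qed
  \<comment> \<open>In front of the inner product with \<open>e\<close> the stepsize is split as
    \<open>\<nu> + (\<alpha> - \<nu>)\<close>: the fixed part stays linear and averages out later,
    while the noise-dependent part is at most \<open>\<theta> * \<beta>\<close> and yields order
    \<open>\<beta>^2\<close>. The decrease is written as twice the half that is to be kept.\<close>
  have linear: "\<alpha> * (\<tau> * (gradf x \<bullet> d) - \<Delta>) \<le> - (2 * (\<nu> * \<sigma> * \<kappa>\<^sub>v * inverse \<kappa>\<^sub>c / 2 * R))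
      + (\<nu> * \<tau> * \<beta>) * (gradf x \<bullet> e)
      + \<beta>^2 * (\<theta> * \<kappa>\<^sub>g * \<tau> * inverse \<zeta> * ((sqrt M + (norm \<delta>)^2 / sqrt M) / 2))"
  proof -
    have "0 \<le> \<tau> * (\<beta> * (u' \<bullet> (H *v u')))" using psd[OF Ju'] merit \<alpha> by simp
    then have "\<tau> * (gradf x \<bullet> d') \<le> (1 - \<sigma>) * \<Delta>"
      using merit(3) by (simp add: \<Delta>_def distrib_left)
    then have "\<tau> * (gradf x \<bullet> d) - \<Delta> \<le> - (\<sigma> * \<Delta>) + \<tau> * \<beta> * (gradf x \<bullet> e)"
      unfolding d d' e_def by (simp add: algebra_simps inner_diff_right inner_add_right)
    then have "\<alpha> * (\<tau> * (gradf x \<bullet> d) - \<Delta>) \<le> \<alpha> * (- (\<sigma> * \<Delta>) + \<tau> * \<beta> * (gradf x \<bullet> e))"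
      using \<alpha> by (intro mult_left_mono) auto
    also have "\<dots> = - (\<alpha> * (\<sigma> * \<Delta>)) + (\<nu> * \<tau> * \<beta>) * (gradf x \<bullet> e)
        + (\<alpha> - \<nu>) * (\<tau> * \<beta> * (gradf x \<bullet> e))"
      by (simp add: algebra_simps)
    also have "- (\<alpha> * (\<sigma> * \<Delta>)) \<le> - (\<nu> * (\<sigma> * (\<kappa>\<^sub>v * inverse \<kappa>\<^sub>c * R)))"
      using \<alpha> merit \<Delta> \<Delta>_ge kv bounds R
      by (intro le_imp_neg_le mult_mono) (auto intro!: mult_nonneg_nonneg)
    also have "(\<alpha> - \<nu>) * (\<tau> * \<beta> * (gradf x \<bullet> e))
      \<le> (\<theta> * \<beta>) * (\<tau> * \<beta> * (\<kappa>\<^sub>g * (inverse \<zeta> * ((sqrt M + (norm \<delta>)^2 / sqrt M) / 2))))"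
    proof -
      have "gradf x \<bullet> e \<le> norm (gradf x) * norm e" by (rule norm_cauchy_schwarz)
      also have "\<dots> \<le> \<kappa>\<^sub>g * (inverse \<zeta> * norm \<delta>)"
        using bounds \<kappa>0 e_le by (intro mult_mono) auto
      also have "\<dots> \<le> \<kappa>\<^sub>g * (inverse \<zeta> * ((sqrt M + (norm \<delta>)^2 / sqrt M) / 2))"
        using amgm H(3) \<kappa>0 by (intro mult_left_mono) auto
      finally have ge: "gradf x \<bullet> e \<le> \<kappa>\<^sub>g * (inverse \<zeta> * ((sqrt M + (norm \<delta>)^2 / sqrt M) / 2))" .
      have "(\<alpha> - \<nu>) * (\<tau> * \<beta> * (gradf x \<bullet> e))
          \<le> (\<alpha> - \<nu>) * (\<tau> * \<beta> * (\<kappa>\<^sub>g * (inverse \<zeta> * ((sqrt M + (norm \<delta>)^2 / sqrt M) / 2))))"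
        using \<alpha> merit by (intro mult_left_mono ge) auto
      also have "\<dots> \<le> (\<theta> * \<beta>) * (\<tau> * \<beta> * (\<kappa>\<^sub>g * (inverse \<zeta> * ((sqrt M + (norm \<delta>)^2 / sqrt M) / 2))))"
        using \<alpha> merit \<kappa>0 H(3) M by (intro mult_right_mono mult_nonneg_nonneg) auto
      finally show ?thesis .
    qed
    finally show ?thesis by (simp add: power2_eq_square mult_ac)
  qed
  have quadratic: "A / 2 * (\<alpha>^2 * (\<beta>^2 * (norm u)^2 + (norm v)^2))
      \<le> (A * \<beta>^2) * (u' \<bullet> e)
        + \<beta>^2 * (1/2 * A * (inverse \<zeta> * \<kappa>\<^sub>H * \<kappa>\<^sub>u^2 + (inverse \<zeta>)^2 * (norm \<delta>)^2))
        + \<nu> * \<sigma> * \<kappa>\<^sub>v * inverse \<kappa>\<^sub>c / 2 * R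
        + \<beta>^2 * (\<theta>^2 * A * \<omega>^2 * \<kappa>\<^sub>J^2 * \<kappa>\<^sub>c^2)"
  proof -
    have "u = u' + e" by (simp add: e_def)
    then have "(norm u)^2 = (norm u')^2 + 2 * (u' \<bullet> e) + (norm e)^2"
      by (simp add: power2_norm_eq_inner inner_add_left inner_add_right inner_commute)
    then have u_sq: "(norm u)^2
        \<le> 2 * (u' \<bullet> e) + (inverse \<zeta> * \<kappa>\<^sub>H * \<kappa>\<^sub>u^2 + (inverse \<zeta>)^2 * (norm \<delta>)^2)"
      using u'_sq e_sq by simp
    \<comment> \<open>The stepsize is removed before the square of \<open>norm u\<close> is expanded
      around \<open>u'\<close>: the cross term has no sign, and its coefficient must not involve
      \<open>\<alpha>\<close>.\<close>
    have "\<alpha>^2 * (\<beta>^2 * (norm u)^2) \<le> 1 * (\<beta>^2 * (norm u)^2)"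
      using \<alpha> by (intro mult_right_mono) (auto simp: power_le_one)
    also have "\<dots> \<le> \<beta>^2 * (2 * (u' \<bullet> e) + (inverse \<zeta> * \<kappa>\<^sub>H * \<kappa>\<^sub>u^2 + (inverse \<zeta>)^2 * (norm \<delta>)^2))"
      using mult_left_mono[OF u_sq, of "\<beta>^2"] by simp
    finally have u_part: "A / 2 * (\<alpha>^2 * (\<beta>^2 * (norm u)^2)) \<le> A / 2 * (\<beta>^2 *
        (2 * (u' \<bullet> e) + (inverse \<zeta> * \<kappa>\<^sub>H * \<kappa>\<^sub>u^2 + (inverse \<zeta>)^2 * (norm \<delta>)^2)))"
      using A by (intro mult_left_mono) auto
    have \<nu>': "A * \<nu> * \<omega>^2 \<le> \<sigma> * \<kappa>\<^sub>v * inverse \<kappa>\<^sub>c / 2"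
    proof -
      have "0 < 2 * A * \<omega>^2" using A v(1) by simp
      then have "\<nu> * (2 * A * \<omega>^2) \<le> \<sigma> * \<kappa>\<^sub>v * inverse \<kappa>\<^sub>c"
        using \<nu> by (simp only: A_def[symmetric] pos_le_divide_eq)
      then show ?thesis by (simp add: mult_ac)
    qed
    \<comment> \<open>Of the two squares, \<open>\<nu>^2\<close> is absorbed into half of the
      decrease by the upper bound on \<open>\<nu>\<close>, and \<open>\<theta>^2 * \<beta>^2\<close>
      joins the remainder.\<close>
    have "\<alpha>^2 \<le> (\<nu> + \<theta> * \<beta>)^2" using \<alpha> by (intro power_mono) auto
    also have "\<dots> \<le> 2 * (\<nu>^2 + \<theta>^2 * \<beta>^2)"
      using zero_le_power2[of "\<nu> - \<theta> * \<beta>"] by (simp add: power2_eq_square algebra_simps)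
    finally have "\<alpha>^2 * (norm v)^2 \<le> 2 * (\<nu>^2 + \<theta>^2 * \<beta>^2) * (\<omega>^2 * R)"
      using v_sq by (intro mult_mono) auto
    then have "A / 2 * (\<alpha>^2 * (norm v)^2) \<le> A / 2 * (2 * (\<nu>^2 + \<theta>^2 * \<beta>^2) * (\<omega>^2 * R))"
      using A by (intro mult_left_mono) auto
    also have "\<dots> = \<nu> * R * (A * \<nu> * \<omega>^2) + \<beta>^2 * (\<theta>^2 * A * \<omega>^2) * R"
      by (simp add: power2_eq_square algebra_simps)
    also have "\<nu> * R * (A * \<nu> * \<omega>^2) \<le> \<nu> * R * (\<sigma> * \<kappa>\<^sub>v * inverse \<kappa>\<^sub>c / 2)"
      using \<nu>' R \<alpha> by (intro mult_left_mono) auto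
    also have "\<beta>^2 * (\<theta>^2 * A * \<omega>^2) * R \<le> \<beta>^2 * (\<theta>^2 * A * \<omega>^2) * (\<kappa>\<^sub>J^2 * \<kappa>\<^sub>c^2)"
      using R A by (intro mult_left_mono) auto
    finally have "A / 2 * (\<alpha>^2 * (norm v)^2)
        \<le> \<nu> * R * (\<sigma> * \<kappa>\<^sub>v * inverse \<kappa>\<^sub>c / 2) + \<beta>^2 * (\<theta>^2 * A * \<omega>^2) * (\<kappa>\<^sub>J^2 * \<kappa>\<^sub>c^2)"
      by simp
    with u_part show ?thesis by (simp add: distrib_left mult_ac)
  qed
  \<comment> \<open>Here \<open>h\<close> is the retained half of the decrease:
    \<open>linear\<close> supplies it twice and \<open>quadratic\<close> spends it once.\<close>
  have combine: "m' \<le> m - h + (p + r) + (t + s + w)"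
    if "m' \<le> m + l + q" "l \<le> - (2 * h) + p + s" "q \<le> r + t + h + w"
    for m m' h p r t s w l q :: real
    using that by linarith
  have "\<tau> * f (x + \<alpha> *\<^sub>R d) + norm (c (x + \<alpha> *\<^sub>R d)) \<le> \<tau> * f x + norm (c x)
    + \<alpha> * (\<tau> * (gradf x \<bullet> d) - \<Delta>) + A / 2 * (\<alpha>^2 * (\<beta>^2 * (norm u)^2 + (norm v)^2))"
    using merit_function_upper_bound[OF smooth x d Ju v_range] \<alpha> merit by (simp add: A_def \<Delta>_def)
  then have "\<tau> * f (x + \<alpha> *\<^sub>R d) + norm (c (x + \<alpha> *\<^sub>R d)) \<le> \<tau> * f x + norm (c x)
      - \<nu> * \<sigma> * \<kappa>\<^sub>v * inverse \<kappa>\<^sub>c / 2 * R + ((\<nu> * \<tau> * \<beta>) *\<^sub>R gradf x + (A * \<beta>^2) *\<^sub>R u') \<bullet> e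
      + \<beta>^2 * (1/2 * A * (inverse \<zeta> * \<kappa>\<^sub>H * \<kappa>\<^sub>u^2 + (inverse \<zeta>)^2 * (norm \<delta>)^2)
          + \<theta> * \<kappa>\<^sub>g * \<tau> * inverse \<zeta> * ((sqrt M + (norm \<delta>)^2 / sqrt M) / 2)
          + \<theta>^2 * A * \<omega>^2 * \<kappa>\<^sub>J^2 * \<kappa>\<^sub>c^2)"
    unfolding inner_add_left inner_scaleR_left distrib_left[of "\<beta>^2"]
    using linear quadratic by (rule combine)
  then show "\<tau> * f (x + \<alpha> *\<^sub>R d) + norm (c (x + \<alpha> *\<^sub>R d)) \<le> \<tau> * f x + norm (c x)
      - \<nu> * \<sigma> * \<kappa>\<^sub>v * inverse \<kappa>\<^sub>c / 2 * (norm (transpose (J x) *v c x))^2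
      + ((\<nu> * \<tau> * \<beta>) *\<^sub>R gradf x + ((\<tau> * L + \<Gamma>) * \<beta>^2) *\<^sub>R u') \<bullet> (u - u')
      + \<beta>^2 * (1/2 * (\<tau> * L + \<Gamma>)
            * (inverse \<zeta> * \<kappa>\<^sub>H * \<kappa>\<^sub>u^2 + (inverse \<zeta>)^2 * (norm (g - gradf x))^2)
          + \<theta> * \<kappa>\<^sub>g * \<tau> * inverse \<zeta> * ((sqrt M + (norm (g - gradf x))^2 / sqrt M) / 2)
          + \<theta>^2 * (\<tau> * L + \<Gamma>) * \<omega>^2 * \<kappa>\<^sub>J^2 * \<kappa>\<^sub>c^2)"
    unfolding A_def R_def \<delta>_def e_def .
qed

section \<open>Mean and second moment of the gradient noise\<close>

text \<open>Averaging the conditional bound with weight 1, first in the extended nonnegative reals,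
  makes finiteness of the second moment a conclusion. A bounded history-measurable \<open>w\<close>
  can be pulled through the conditional mean; this is done coordinatewise, where the conditional
  expectation is scalar.\<close>

lemma (in prob_space) gradient_noise:
  assumes sub: "subalgebra M F"
    and g: "g \<in> borel_measurable M" and G: "G \<in> borel_measurable F"
    and G_le: "\<And>\<xi>. \<xi> \<in> space M \<Longrightarrow> norm (G \<xi>) \<le> \<kappa>"
    and grad: "0 < V" "gradient_assumption M F g G V"
  shows "integrable M (\<lambda>\<xi>. (norm (g \<xi> - G \<xi>))^2)"
    and "expectation (\<lambda>\<xi>. (norm (g \<xi> - G \<xi>))^2) \<le> V"
    and "w \<in> borel_measurable F \<Longrightarrow> (\<And>\<xi>. \<xi> \<in> space M \<Longrightarrow> norm (w \<xi>) \<le> B)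
      \<Longrightarrow> integrable M (\<lambda>\<xi>. w \<xi> \<bullet> (g \<xi> - G \<xi>))"
    and "w \<in> borel_measurable F \<Longrightarrow> (\<And>\<xi>. \<xi> \<in> space M \<Longrightarrow> norm (w \<xi>) \<le> B)
      \<Longrightarrow> expectation (\<lambda>\<xi>. w \<xi> \<bullet> (g \<xi> - G \<xi>)) = 0"
proof -
  interpret finite_measure_subalgebra M F
    by unfold_locales (rule sub)
  note g [measurable]
  have G_M [measurable]: "G \<in> borel_measurable M" by (rule measurable_from_subalg[OF sub G])
  define D where "D \<xi> = (norm (g \<xi> - G \<xi>))^2" for \<xi>
  have D_meas [measurable]: "D \<in> borel_measurable M" unfolding D_def by measurable
  have "(\<integral>\<^sup>+ \<xi>. ennreal (D \<xi>) \<partial>M) = (\<integral>\<^sup>+ \<xi>. 1 * nn_cond_exp M F (\<lambda>\<xi>. ennreal (D \<xi>)) \<xi> \<partial>M)"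
    by (subst nn_cond_exp_intg) auto
  also have "\<dots> \<le> (\<integral>\<^sup>+ \<xi>. ennreal V \<partial>M)"
    using grad(2) by (intro nn_integral_mono_AE) (simp add: gradient_assumption_def D_def)
  also have "\<dots> = ennreal V" by (simp add: emeasure_space_1)
  finally have nn: "(\<integral>\<^sup>+ \<xi>. ennreal (D \<xi>) \<partial>M) \<le> ennreal V" .
  have D_int: "integrable M D"
  proof (rule integrableI_nonneg)
    show "(\<integral>\<^sup>+ \<xi>. ennreal (D \<xi>) \<partial>M) < \<infinity>" using nn by (rule le_less_trans) simp
  qed (auto simp: D_def)
  have "ennreal (expectation D) = (\<integral>\<^sup>+ \<xi>. ennreal (D \<xi>) \<partial>M)"
    by (rule nn_integral_eq_integral[symmetric, OF D_int]) (simp add: D_def)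
  then have D_le: "expectation D \<le> V" using nn grad(1) by (metis ennreal_le_iff less_imp_le)
  show "integrable M (\<lambda>\<xi>. (norm (g \<xi> - G \<xi>))^2)" using D_int by (simp add: D_def[abs_def])
  show "expectation (\<lambda>\<xi>. (norm (g \<xi> - G \<xi>))^2) \<le> V" using D_le by (simp add: D_def[abs_def])
  \<comment> \<open>Domination of the first power by the square gives one integrable bound,
    \<open>B * (\<kappa> + (1 + D \<xi>))\<close>, for all products below.\<close>
  have \<delta>_le: "norm (g \<xi> - G \<xi>) \<le> 1 + D \<xi>" for \<xi>
  proof -
    have "r \<le> 1 + r^2" if "0 \<le> r" for r :: real
      using zero_le_power2[of "r - 1"] that by (simp add: power2_diff)
    then show ?thesis by (simp add: D_def)
  qed
  assume w: "w \<in> borel_measurable F" and w_le: "\<And>\<xi>. \<xi> \<in> space M \<Longrightarrow> norm (w \<xi>) \<le> B"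
  have w_M [measurable]: "w \<in> borel_measurable M" by (rule measurable_from_subalg[OF sub w])
  have B: "0 \<le> B" using w_le not_empty by (meson equals0I norm_ge_zero order_trans)
  have bound: "norm (w \<xi>) * (norm (G \<xi>) + norm (g \<xi> - G \<xi>)) \<le> B * (\<kappa> + (1 + D \<xi>))"
    if "\<xi> \<in> space M" for \<xi>
    using w_le[OF that] G_le[OF that] \<delta>_le B by (intro mult_mono add_mono) auto
  have bound_int: "integrable M (\<lambda>\<xi>. B * (\<kappa> + (1 + D \<xi>)))"
    using D_int by simp
  show wd: "integrable M (\<lambda>\<xi>. w \<xi> \<bullet> (g \<xi> - G \<xi>))"
  proof (rule Bochner_Integration.integrable_bound[OF bound_int])
    show "AE \<xi> in M. norm (w \<xi> \<bullet> (g \<xi> - G \<xi>)) \<le> norm (B * (\<kappa> + (1 + D \<xi>)))"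
    proof (rule AE_I2)
      fix \<xi> assume "\<xi> \<in> space M"
      have "norm (w \<xi> \<bullet> (g \<xi> - G \<xi>)) \<le> norm (w \<xi>) * norm (g \<xi> - G \<xi>)"
        using Cauchy_Schwarz_ineq2 by simp
      also have "\<dots> \<le> norm (w \<xi>) * (norm (G \<xi>) + norm (g \<xi> - G \<xi>))"
        by (intro mult_left_mono) auto
      finally show "norm (w \<xi> \<bullet> (g \<xi> - G \<xi>)) \<le> norm (B * (\<kappa> + (1 + D \<xi>)))"
        using bound[OF \<open>\<xi> \<in> space M\<close>] by simp
    qed
  qed simp
  \<comment> \<open>Integrability is shown for each product separately, since the pull-out rule is
    applied to \<open>g\<close> and not to the difference \<open>g - G\<close>.\<close>
  have wG: "integrable M (\<lambda>\<xi>. w \<xi> $ i * G \<xi> $ i)" and wg: "integrable M (\<lambda>\<xi>. w \<xi> $ i * g \<xi> $ i)"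
    for i
  proof -
    have meas: "(\<lambda>\<xi>. w \<xi> $ i) \<in> borel_measurable M" "(\<lambda>\<xi>. G \<xi> $ i) \<in> borel_measurable M"
      "(\<lambda>\<xi>. g \<xi> $ i) \<in> borel_measurable M"
      using w_M G_M g by (simp_all add: borel_measurable_vec_iff)
    have ineq: "\<bar>w \<xi> $ i * y $ i\<bar> \<le> B * (\<kappa> + (1 + D \<xi>))"
      if "\<xi> \<in> space M" "norm y \<le> norm (G \<xi>) + norm (g \<xi> - G \<xi>)" for \<xi> y
    proof -
      have "\<bar>w \<xi> $ i * y $ i\<bar> \<le> norm (w \<xi>) * norm y"
        unfolding abs_mult by (intro mult_mono component_le_norm_cart) auto
      also have "\<dots> \<le> norm (w \<xi>) * (norm (G \<xi>) + norm (g \<xi> - G \<xi>))"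
        using that by (intro mult_left_mono) auto
      finally show ?thesis using bound[OF that(1)] by simp
    qed
    have "norm (g \<xi>) \<le> norm (G \<xi>) + norm (g \<xi> - G \<xi>)" for \<xi>
      using norm_triangle_ineq[of "G \<xi>" "g \<xi> - G \<xi>"] by simp
    then show "integrable M (\<lambda>\<xi>. w \<xi> $ i * g \<xi> $ i)"
      using ineq meas
      by (intro Bochner_Integration.integrable_bound[OF bound_int] AE_I2 borel_measurable_times)
         (auto intro: order_trans[OF _ abs_ge_self])
    show "integrable M (\<lambda>\<xi>. w \<xi> $ i * G \<xi> $ i)"
      using ineq meas
      by (intro Bochner_Integration.integrable_bound[OF bound_int] AE_I2 borel_measurable_times)
         (auto intro: order_trans[OF _ abs_ge_self])
  qed
  have eq: "expectation (\<lambda>\<xi>. w \<xi> $ i * g \<xi> $ i) = expectation (\<lambda>\<xi>. w \<xi> $ i * G \<xi> $ i)" for i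
  proof -
    have "expectation (\<lambda>\<xi>. w \<xi> $ i * g \<xi> $ i)
        = expectation (\<lambda>\<xi>. w \<xi> $ i * real_cond_exp M F (\<lambda>\<xi>. g \<xi> $ i) \<xi>)"
      using w g by (intro real_cond_exp_intg(2)[symmetric] wg) (simp_all add: borel_measurable_vec_iff)
    also have "\<dots> = expectation (\<lambda>\<xi>. w \<xi> $ i * G \<xi> $ i)"
    proof (rule integral_cong_AE)
      have "AE \<xi> in M. vec_cond_exp M F g \<xi> = G \<xi>"
        using grad(2) by (simp add: gradient_assumption_def)
      then show "AE \<xi> in M. w \<xi> $ i * real_cond_exp M F (\<lambda>\<xi>. g \<xi> $ i) \<xi> = w \<xi> $ i * G \<xi> $ i"
        by eventually_elim (auto simp: vec_cond_exp_def vec_eq_iff)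
    qed (use w_M G_M in \<open>auto simp: borel_measurable_vec_iff
        intro!: borel_measurable_times borel_measurable_cond_exp2\<close>)
    finally show ?thesis .
  qed
  have "expectation (\<lambda>\<xi>. w \<xi> \<bullet> (g \<xi> - G \<xi>))
      = expectation (\<lambda>\<xi>. \<Sum>i\<in>UNIV. w \<xi> $ i * g \<xi> $ i - w \<xi> $ i * G \<xi> $ i)"
    by (simp add: inner_vec_def right_diff_distrib)
  also have "\<dots> = (\<Sum>i\<in>UNIV. expectation (\<lambda>\<xi>. w \<xi> $ i * g \<xi> $ i - w \<xi> $ i * G \<xi> $ i))"
    using wg wG by (intro Bochner_Integration.integral_sum) simp
  also have "\<dots> = 0" using wg wG eq by simp
  finally show "expectation (\<lambda>\<xi>. w \<xi> \<bullet> (g \<xi> - G \<xi>)) = 0" .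
qed

section \<open>Expected decrease per iteration and its telescoped sum\<close>

text \<open>The function \<open>h\<close> may be arbitrary outside \<open>X\<close>, so the argument
  passes through the Borel space restricted to \<open>X\<close>.\<close>

lemma borel_measurable_continuous_on_compose:
  assumes "continuous_on X h" "x \<in> borel_measurable M" "\<And>\<xi>. \<xi> \<in> space M \<Longrightarrow> x \<xi> \<in> X"
  shows "(\<lambda>\<xi>. h (x \<xi>)) \<in> borel_measurable M"
proof -
  have x: "x \<in> measurable M (restrict_space borel X)"
    using assms by (intro measurable_restrict_space2) auto
  show ?thesis
    by (rule measurable_compose[OF x borel_measurable_continuous_on_restrict[OF assms(1)]])
qed

theorem corollary3p12:
  fixes P :: "'w measure" and F :: "nat \<Rightarrow> 'w measure"
    and X :: "(real^'n) set"
    and f :: "real^'n \<Rightarrow> real" and gradf :: "real^'n \<Rightarrow> real^'n"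
    and c :: "real^'n \<Rightarrow> real^'m" and J :: "real^'n \<Rightarrow> real^'n^'m"
    and x0 :: "real^'n"
    and x g u v d u_true d_true :: "nat \<Rightarrow> 'w \<Rightarrow> real^'n"
    and H :: "nat \<Rightarrow> 'w \<Rightarrow> real^'n^'n"
    and \<alpha> \<alpha>\<^sub>C :: "nat \<Rightarrow> 'w \<Rightarrow> real" and \<beta> :: "nat \<Rightarrow> real"
    and L \<Gamma> f_inf \<kappa>\<^sub>g \<kappa>\<^sub>c \<kappa>\<^sub>J \<kappa>\<^sub>H \<zeta> M \<omega> \<epsilon>\<^sub>v \<kappa>\<^sub>\<beta> \<sigma> \<tau>\<^sub>m\<^sub>i\<^sub>n \<kappa>\<^sub>v \<kappa>\<^sub>u \<kappa>\<^sub>1 \<kappa>\<^sub>2 \<theta> \<nu> \<eta> :: real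
    and K :: nat
  assumes prob: "prob_space P"
    and history: "filtration (space P) F" "\<And>k. subalgebra P (F k)"
      "\<And>k. x k \<in> borel_measurable (F k)" "\<And>k. v k \<in> borel_measurable (F k)"
      "\<And>k. H k \<in> borel_measurable (F k)"
    and random_variables: "\<And>k. g k \<in> borel_measurable P" "\<And>k. \<alpha> k \<in> borel_measurable P"
    \<comment> \<open>Smoothness Assumption and the constants fixed by it\<close>
    and smooth: "smoothness_assumption X f gradf c J L \<Gamma>"
    and iterates_in_X: "\<And>k \<xi>. \<xi> \<in> space P \<Longrightarrow> x k \<xi> \<in> X"
    and f_inf: "\<And>k \<xi>. \<xi> \<in> space P \<Longrightarrow> f_inf \<le> f (x k \<xi>)"
    and kappa_g: "\<kappa>\<^sub>g > 0" "\<And>k \<xi>. \<xi> \<in> space P \<Longrightarrow> norm (gradf (x k \<xi>)) \<le> \<kappa>\<^sub>g"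
    and kappa_c: "\<kappa>\<^sub>c > 0" "\<And>k \<xi>. \<xi> \<in> space P \<Longrightarrow> norm (c (x k \<xi>)) \<le> \<kappa>\<^sub>c"
    and kappa_J: "\<kappa>\<^sub>J > 0" "\<And>k \<xi>. \<xi> \<in> space P \<Longrightarrow> opnorm (J (x k \<xi>)) \<le> \<kappa>\<^sub>J"
    \<comment> \<open>Hessian Assumption\<close>
    and H_symmetric: "\<And>k \<xi>. \<xi> \<in> space P \<Longrightarrow> transpose (H k \<xi>) = H k \<xi>"
    and H_bounded: "\<And>k \<xi>. \<xi> \<in> space P \<Longrightarrow> opnorm (H k \<xi>) \<le> \<kappa>\<^sub>H"
    and H_curvature: "\<zeta> > 0" "\<And>k \<xi> w. \<xi> \<in> space P \<Longrightarrow> J (x k \<xi>) *v w = 0 \<Longrightarrow>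
          w \<bullet> (H k \<xi> *v w) \<ge> \<zeta> * (norm w)^2"
    \<comment> \<open>Gradient Assumption\<close>
    and gradient: "M > 0" "\<And>k. gradient_assumption P (F k) (g k) (\<lambda>\<xi>. gradf (x k \<xi>)) M"
    \<comment> \<open>The exact algorithm\<close>
    and start: "\<And>\<xi>. \<xi> \<in> space P \<Longrightarrow> x 0 \<xi> = x0"
    and step1: "\<omega> > 0" "0 < \<epsilon>\<^sub>v" "\<epsilon>\<^sub>v \<le> 1" "\<And>k \<xi>. \<xi> \<in> space P \<Longrightarrow>
          normal_step \<omega> \<epsilon>\<^sub>v (c (x k \<xi>)) (J (x k \<xi>)) (\<alpha>\<^sub>C k \<xi>) (v k \<xi>)"
    and step2: "\<And>k \<xi>. \<xi> \<in> space P \<Longrightarrow>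
          tangential_step (g k \<xi>) (H k \<xi>) (v k \<xi>) (J (x k \<xi>)) (u k \<xi>)"
    and step3: "\<kappa>\<^sub>\<beta> > 0" "\<And>k. 0 < \<beta> k" "\<And>k. \<beta> k \<le> \<kappa>\<^sub>\<beta>"
          "\<And>k \<xi>. \<xi> \<in> space P \<Longrightarrow> d k \<xi> = \<beta> k *\<^sub>R u k \<xi> + v k \<xi>"
    and step4: "\<And>k \<xi>. \<xi> \<in> space P \<Longrightarrow> \<alpha> k \<xi> > 0"
          "\<And>k \<xi>. \<xi> \<in> space P \<Longrightarrow> x (Suc k) \<xi> = x k \<xi> + \<alpha> k \<xi> *\<^sub>R d k \<xi>"
    \<comment> \<open>True quantities\<close>
    and u_true: "\<And>k \<xi>. \<xi> \<in> space P \<Longrightarrow>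
          tangential_step (gradf (x k \<xi>)) (H k \<xi>) (v k \<xi>) (J (x k \<xi>)) (u_true k \<xi>)"
    and d_true: "\<And>k \<xi>. \<xi> \<in> space P \<Longrightarrow> d_true k \<xi> = \<beta> k *\<^sub>R u_true k \<xi> + v k \<xi>"
    \<comment> \<open>Merit-parameter Assumption\<close>
    and merit: "0 < \<sigma>" "\<sigma> < 1" "\<tau>\<^sub>m\<^sub>i\<^sub>n > 0" "\<And>k \<xi>. \<xi> \<in> space P \<Longrightarrow>
          \<tau>\<^sub>m\<^sub>i\<^sub>n * (gradf (x k \<xi>) \<bullet> d_true k \<xi> + \<beta> k * (u_true k \<xi> \<bullet> (H k \<xi> *v u_true k \<xi>)))
            \<le> (1 - \<sigma>) * (norm (c (x k \<xi>)) - norm (c (x k \<xi>) + J (x k \<xi>) *v v k \<xi>))"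
    \<comment> \<open>Constants\<close>
    and kappa_v: "\<kappa>\<^sub>v > 0" "\<And>k \<xi>. \<xi> \<in> space P \<Longrightarrow>
          norm (c (x k \<xi>)) * (norm (c (x k \<xi>)) - norm (c (x k \<xi>) + J (x k \<xi>) *v v k \<xi>))
            \<ge> \<kappa>\<^sub>v * (norm (transpose (J (x k \<xi>)) *v c (x k \<xi>)))^2"
    and kappa_u: "\<kappa>\<^sub>u = inverse \<zeta> * (\<kappa>\<^sub>g + \<kappa>\<^sub>H * \<omega> * \<kappa>\<^sub>J * \<kappa>\<^sub>c)"
    and kappa_1: "\<kappa>\<^sub>1 = (1/2) * (\<tau>\<^sub>m\<^sub>i\<^sub>n * L + \<Gamma>) * (inverse \<zeta> * \<kappa>\<^sub>H * \<kappa>\<^sub>u^2 + (inverse \<zeta>)^2 * M)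
            + \<theta> * \<kappa>\<^sub>g * \<tau>\<^sub>m\<^sub>i\<^sub>n * inverse \<zeta> * sqrt M
            + \<theta>^2 * (\<tau>\<^sub>m\<^sub>i\<^sub>n * L + \<Gamma>) * \<omega>^2 * \<kappa>\<^sub>J^2 * \<kappa>\<^sub>c^2"
    \<comment> \<open>Hypotheses of the corollary\<close>
    and theta: "\<theta> > 0"
    and nu: "\<nu> \<in> {0<..min (\<sigma> * \<kappa>\<^sub>v * inverse \<kappa>\<^sub>c / (2 * (\<tau>\<^sub>m\<^sub>i\<^sub>n * L + \<Gamma>) * \<omega>^2)) (1 - \<theta> * \<kappa>\<^sub>\<beta>)}"
    and stepsizes: "\<And>k \<xi>. \<xi> \<in> space P \<Longrightarrow> \<alpha> k \<xi> \<in> {\<nu>..\<nu> + \<theta> * \<beta> k}"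
    and K: "K \<ge> 1"
    and eta: "\<eta> > 0"
    and beta_const: "\<And>k. k < K \<Longrightarrow> \<beta> k = \<eta> / sqrt (real K)"
    and kappa_2: "\<kappa>\<^sub>2 = \<tau>\<^sub>m\<^sub>i\<^sub>n * (f x0 - f_inf) + norm (c x0) + \<eta>^2 * \<kappa>\<^sub>1"
  shows "(1 / real K) *
           (\<Sum>k<K. prob_space.expectation P (\<lambda>\<xi>. (norm (transpose (J (x k \<xi>)) *v c (x k \<xi>)))^2))
         \<le> (2 * \<kappa>\<^sub>c * \<kappa>\<^sub>2) / (\<nu> * \<sigma> * \<kappa>\<^sub>v * real K)"
proof -
  interpret prob_space P by (rule prob)
  define A where "A = \<tau>\<^sub>m\<^sub>i\<^sub>n * L + \<Gamma>"
  define C where "C = \<nu> * \<sigma> * \<kappa>\<^sub>v * inverse \<kappa>\<^sub>c / 2"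
  define R where "R k \<xi> = (norm (transpose (J (x k \<xi>)) *v c (x k \<xi>)))^2" for k \<xi>
  define \<phi> where "\<phi> k \<xi> = \<tau>\<^sub>m\<^sub>i\<^sub>n * f (x k \<xi>) + norm (c (x k \<xi>))" for k \<xi>
  note space_F = history(2)[unfolded subalgebra_def, THEN conjunct1]
  have \<nu>: "0 < \<nu>" "\<nu> \<le> \<sigma> * \<kappa>\<^sub>v * inverse \<kappa>\<^sub>c / (2 * (\<tau>\<^sub>m\<^sub>i\<^sub>n * L + \<Gamma>) * \<omega>^2)" "\<nu> \<le> 1 - \<theta> * \<kappa>\<^sub>\<beta>"
    using nu by auto
  have C: "C > 0" using \<nu> merit kappa_v kappa_c by (simp add: C_def)
  have cont: "continuous_on X f" "continuous_on X c" "continuous_on X gradf" "continuous_on X J"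
  proof -
    show "continuous_on X f"
    proof (rule continuous_at_imp_continuous_on, rule ballI)
      fix y assume "y \<in> X"
      then have "GDERIV f y :> gradf y" using smooth by (simp add: smoothness_assumption_def)
      then show "isCont f y" unfolding gderiv_def by (rule has_derivative_continuous)
    qed
    show "continuous_on X c"
    proof (rule continuous_at_imp_continuous_on, rule ballI)
      fix y assume "y \<in> X"
      then have "(c has_derivative (\<lambda>h. J y *v h)) (at y)"
        using smooth by (simp add: smoothness_assumption_def)
      then show "isCont c y" by (rule has_derivative_continuous)
    qed
    show "continuous_on X gradf" "continuous_on X J"
      using smooth by (simp_all add: smoothness_assumption_def)
  qed
  have meas: "(\<lambda>\<xi>. h (x k \<xi>)) \<in> borel_measurable (F k)" if "continuous_on X h"
    for k and h :: "real^'n \<Rightarrow> 'b::topological_space"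
    using that history(3) by (rule borel_measurable_continuous_on_compose) (simp add: space_F iterates_in_X)
  note meas_P = measurable_from_subalg[OF history(2)]
  have \<phi>_int: "integrable P (\<phi> k)" for k
  proof -
    obtain b where b: "\<And>y. y \<in> X \<Longrightarrow> norm (f y) \<le> b"
      using smooth by (force simp: smoothness_assumption_def bounded_iff)
    show ?thesis
    proof (rule integrable_const_bound)
      show "AE \<xi> in P. norm (\<phi> k \<xi>) \<le> \<tau>\<^sub>m\<^sub>i\<^sub>n * b + \<kappa>\<^sub>c"
      proof (rule AE_I2)
        fix \<xi> assume \<xi>: "\<xi> \<in> space P"
        have "norm (\<phi> k \<xi>) \<le> \<tau>\<^sub>m\<^sub>i\<^sub>n * norm (f (x k \<xi>)) + norm (c (x k \<xi>))"
          unfolding \<phi>_def using merit(3) by (intro norm_triangle_le) (simp add: abs_mult)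
        also have "\<dots> \<le> \<tau>\<^sub>m\<^sub>i\<^sub>n * b + \<kappa>\<^sub>c"
          using merit(3) \<xi> by (intro add_mono mult_left_mono b iterates_in_X kappa_c) auto
        finally show "norm (\<phi> k \<xi>) \<le> \<tau>\<^sub>m\<^sub>i\<^sub>n * b + \<kappa>\<^sub>c" .
      qed
      show "\<phi> k \<in> borel_measurable P"
        unfolding \<phi>_def using meas_P[OF meas[OF cont(1)]] meas_P[OF meas[OF cont(2)]] by simp
    qed
  qed
  have R_int: "integrable P (R k)" for k
  proof (rule integrable_const_bound)
    show "AE \<xi> in P. norm (R k \<xi>) \<le> (\<kappa>\<^sub>J * \<kappa>\<^sub>c)^2"
      unfolding R_def real_norm_def abs_power2
      using kappa_J(2) kappa_c(2)
      by (intro AE_I2 power_mono norm_transpose_matrix_vector_mult_le) auto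
    show "R k \<in> borel_measurable P"
      unfolding R_def
      by (intro borel_measurable_power measurable_compose[OF _ borel_measurable_norm]
          borel_measurable_matrix_vector_mult
          borel_measurable_transpose meas_P[OF meas[OF cont(4)]] meas_P[OF meas[OF cont(2)]])
  qed
  have step: "expectation (\<phi> (Suc k)) \<le> expectation (\<phi> k) - C * expectation (R k) + (\<beta> k)^2 * \<kappa>\<^sub>1" for k
  proof -
    let ?b = "\<beta> k" and ?\<delta> = "\<lambda>\<xi>. g k \<xi> - gradf (x k \<xi>)"
    \<comment> \<open>All coefficients of \<open>u k - u_true k\<close>. They contain the fixed
      \<open>\<nu>\<close> and not \<open>\<alpha> k\<close>, so \<open>y\<close> depends on the
      history only.\<close>
    define y where "y \<xi> = (\<nu> * \<tau>\<^sub>m\<^sub>i\<^sub>n * ?b) *\<^sub>R gradf (x k \<xi>) + (A * ?b^2) *\<^sub>R u_true k \<xi>" for \<xi>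
    define D where "D \<xi> = (norm (?\<delta> \<xi>))^2" for \<xi>
    \<comment> \<open>The remainder is affine in the squared noise \<open>D\<close>, with constant
      \<open>p\<close> and slope \<open>q\<close>; the value at \<open>D = M\<close> is
      \<open>\<kappa>\<^sub>1\<close>, and \<open>q \<ge> 0\<close> allows the expectation of
      \<open>D\<close> to be replaced by \<open>M\<close>.\<close>
    define p where "p = 1/2 * A * (inverse \<zeta> * \<kappa>\<^sub>H * \<kappa>\<^sub>u^2) + \<theta> * \<kappa>\<^sub>g * \<tau>\<^sub>m\<^sub>i\<^sub>n * inverse \<zeta> * (sqrt M / 2)
        + \<theta>^2 * A * \<omega>^2 * \<kappa>\<^sub>J^2 * \<kappa>\<^sub>c^2"
    define q where "q = 1/2 * A * (inverse \<zeta>)^2 + \<theta> * \<kappa>\<^sub>g * \<tau>\<^sub>m\<^sub>i\<^sub>n * inverse \<zeta> * (1 / sqrt M / 2)"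
    have A: "A > 0"
      using smooth merit(3) by (auto simp: A_def smoothness_assumption_def intro!: add_pos_pos)
    have q: "0 \<le> q"
      using A theta kappa_g(1) merit(3) H_curvature(1) gradient(1) by (simp add: q_def)
    have pq: "p + q * M = \<kappa>\<^sub>1"
    proof -
      have M: "1 / sqrt M / 2 * M = sqrt M / 2" using gradient(1) by (simp add: real_div_sqrt)
      have "\<theta> * \<kappa>\<^sub>g * \<tau>\<^sub>m\<^sub>i\<^sub>n * inverse \<zeta> * (1 / sqrt M / 2) * M
          = \<theta> * \<kappa>\<^sub>g * \<tau>\<^sub>m\<^sub>i\<^sub>n * inverse \<zeta> * (sqrt M / 2)" by (simp only: mult.assoc M)
      then show ?thesis
        unfolding p_def q_def kappa_1 A_def[symmetric] by (simp add: algebra_simps)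
    qed
    have psd: "0 \<le> z \<bullet> (H k \<xi> *v z)" and pd: "z \<noteq> 0 \<Longrightarrow> 0 < z \<bullet> (H k \<xi> *v z)"
      if "\<xi> \<in> space P" "J (x k \<xi>) *v z = 0" for \<xi> z
    proof -
      have "0 \<le> \<zeta> * (norm z)^2" "z \<noteq> 0 \<Longrightarrow> 0 < \<zeta> * (norm z)^2" using H_curvature(1) by auto
      then show "0 \<le> z \<bullet> (H k \<xi> *v z)" "z \<noteq> 0 \<Longrightarrow> 0 < z \<bullet> (H k \<xi> *v z)"
        using H_curvature(2)[OF that] by linarith+
    qed
    have solution_meas: "\<exists>w\<in>borel_measurable (F k). \<forall>\<xi>\<in>space P.
        reduced_solution (J (x k \<xi>)) (H k \<xi>) (b \<xi>) (w \<xi>)"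
      if "b \<in> borel_measurable (F k)" for b
      using borel_measurable_reduced_solution[OF meas[OF cont(4)] history(5) that]
      unfolding space_F by (simp add: pd)
    have ru: "reduced_solution (J (x k \<xi>)) (H k \<xi>) (- (g k \<xi> + H k \<xi> *v v k \<xi>)) (u k \<xi>)"
      and ru': "reduced_solution (J (x k \<xi>)) (H k \<xi>) (- (gradf (x k \<xi>) + H k \<xi> *v v k \<xi>)) (u_true k \<xi>)"
      if "\<xi> \<in> space P" for \<xi>
      using that by (intro tangential_step_reduced_solution step2 u_true H_symmetric psd; simp)+
    \<comment> \<open>The minimizer is given only pointwise; uniqueness identifies it with the
      measurable solution of the same reduced system.\<close>
    have u_true_meas: "u_true k \<in> borel_measurable (F k)"
    proof -
      have "(\<lambda>\<xi>. - (gradf (x k \<xi>) + H k \<xi> *v v k \<xi>)) \<in> borel_measurable (F k)"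
        by (intro borel_measurable_uminus borel_measurable_add meas cont
            borel_measurable_matrix_vector_mult history)
      from solution_meas[OF this] obtain w where w: "w \<in> borel_measurable (F k)"
        "\<And>\<xi>. \<xi> \<in> space P \<Longrightarrow> reduced_solution (J (x k \<xi>)) (H k \<xi>)
            (- (gradf (x k \<xi>) + H k \<xi> *v v k \<xi>)) (w \<xi>)"
        by blast
      have "u_true k \<xi> = w \<xi>" if "\<xi> \<in> space (F k)" for \<xi>
        using that unfolding space_F
        by (intro reduced_solution_unique[OF ru' w(2) H_curvature])
      then show ?thesis using w(1) by (simp cong: measurable_cong)
    qed
    have y_meas: "y \<in> borel_measurable (F k)"
      unfolding y_def using u_true_meas meas[OF cont(3), of k] by simp
    from solution_meas[OF this] obtain w where w: "w \<in> borel_measurable (F k)"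
      and rw: "\<And>\<xi>. \<xi> \<in> space P \<Longrightarrow> reduced_solution (J (x k \<xi>)) (H k \<xi>) (y \<xi>) (w \<xi>)"
      by blast
    \<comment> \<open>Each of two reduced systems is tested with the solution of the other, and
      symmetry of \<open>H k \<xi>\<close> equates the results. This removes \<open>u k\<close>, for
      which measurability is not assumed, before expectations are taken.\<close>
    have dual: "y \<xi> \<bullet> (u k \<xi> - u_true k \<xi>) = - (w \<xi> \<bullet> ?\<delta> \<xi>)" if \<xi>: "\<xi> \<in> space P" for \<xi>
    proof -
      let ?e = "u k \<xi> - u_true k \<xi>"
      have re: "reduced_solution (J (x k \<xi>)) (H k \<xi>) (- ?\<delta> \<xi>) ?e"
        using reduced_solution_diff[OF ru ru', OF \<xi> \<xi>] by simp
      then have "?e \<bullet> y \<xi> = ?e \<bullet> (H k \<xi> *v w \<xi>)"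
        using rw[OF \<xi>] by (simp add: reduced_solution_def)
      also have "\<dots> = w \<xi> \<bullet> (H k \<xi> *v ?e)" by (rule symmetric_matrix_inner[OF H_symmetric[OF \<xi>]])
      also have "\<dots> = w \<xi> \<bullet> (- ?\<delta> \<xi>)"
        using rw[OF \<xi>] re by (simp add: reduced_solution_def)
      finally show ?thesis by (simp only: inner_commute[of "y \<xi>"] inner_minus_right)
    qed
    have bound: "norm (u_true k \<xi>) \<le> \<kappa>\<^sub>u"
      and decrease: "\<phi> (Suc k) \<xi> \<le> \<phi> k \<xi> - C * R k \<xi> - w \<xi> \<bullet> ?\<delta> \<xi> + ?b^2 * (p + q * D \<xi>)"
      if \<xi>: "\<xi> \<in> space P" for \<xi>
    proof -
      have \<alpha>: "\<nu> \<le> \<alpha> k \<xi>" "\<alpha> k \<xi> \<le> \<nu> + \<theta> * ?b" using stepsizes[OF \<xi>, of k] by auto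
      \<comment> \<open>Here \<open>\<nu> \<le> 1 - \<theta> * \<kappa>\<^sub>\<beta>\<close>
        enters.\<close>
      have \<alpha>': "\<alpha> k \<xi> \<le> 1"
        using \<alpha> \<nu> mult_left_mono[OF step3(3)[of k], of \<theta>] theta by linarith
      have in_X: "x k \<xi> + \<alpha> k \<xi> *\<^sub>R d k \<xi> \<in> X"
        using iterates_in_X[OF \<xi>, of "Suc k"] by (simp add: step4(2)[OF \<xi>])
      note pointwise = merit_decrease_pointwise[OF smooth iterates_in_X[OF \<xi>] in_X
          kappa_g(2)[OF \<xi>] kappa_c(1) kappa_c(2)[OF \<xi>] kappa_J(2)[OF \<xi>]
          H_symmetric[OF \<xi>] H_bounded[OF \<xi>] H_curvature(1) H_curvature(2)[OF \<xi>]
          step1(1) step1(4)[OF \<xi>] step2[OF \<xi>] step3(4)[OF \<xi>] u_true[OF \<xi>] d_true[OF \<xi>]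
          merit(1,3) merit(4)[OF \<xi>] kappa_v(1) kappa_v(2)[OF \<xi>] kappa_u
          \<nu>(1) \<alpha> \<alpha>' step3(2) theta \<nu>(2) gradient(1), folded A_def]
      show "norm (u_true k \<xi>) \<le> \<kappa>\<^sub>u" by (rule pointwise(1))
      have "\<phi> (Suc k) \<xi> \<le> \<phi> k \<xi> - C * R k \<xi> + y \<xi> \<bullet> (u k \<xi> - u_true k \<xi>) + ?b^2 * (p + q * D \<xi>)"
        using pointwise(2) unfolding \<phi>_def R_def D_def y_def C_def p_def q_def step4(2)[OF \<xi>]
        by (simp add: algebra_simps add_divide_distrib)
      then show "\<phi> (Suc k) \<xi> \<le> \<phi> k \<xi> - C * R k \<xi> - w \<xi> \<bullet> ?\<delta> \<xi> + ?b^2 * (p + q * D \<xi>)"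
        by (simp add: dual[OF \<xi>])
    qed
    \<comment> \<open>A uniform bound on \<open>w\<close> makes its product with the
      square-integrable noise integrable, with mean zero.\<close>
    have w_le: "norm (w \<xi>) \<le> inverse \<zeta> * (\<nu> * \<tau>\<^sub>m\<^sub>i\<^sub>n * ?b * \<kappa>\<^sub>g + A * ?b^2 * \<kappa>\<^sub>u)"
      if \<xi>: "\<xi> \<in> space P" for \<xi>
    proof -
      have coeff: "0 \<le> \<nu> * \<tau>\<^sub>m\<^sub>i\<^sub>n * ?b" "0 \<le> A * ?b^2"
        using \<nu>(1) merit(3) step3(2)[of k] A by (simp_all add: less_imp_le)
      have "norm (y \<xi>) \<le> \<nu> * \<tau>\<^sub>m\<^sub>i\<^sub>n * ?b * norm (gradf (x k \<xi>)) + A * ?b^2 * norm (u_true k \<xi>)"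
        unfolding y_def using coeff by (intro norm_triangle_le) (simp add: abs_of_nonneg)
      also have "\<dots> \<le> \<nu> * \<tau>\<^sub>m\<^sub>i\<^sub>n * ?b * \<kappa>\<^sub>g + A * ?b^2 * \<kappa>\<^sub>u"
        by (intro add_mono mult_left_mono coeff kappa_g bound \<xi>)
      finally show ?thesis
        using reduced_solution_norm_le[OF rw H_curvature, OF \<xi> \<xi>] H_curvature(1)
        by (meson inverse_nonnegative_iff_nonnegative less_imp_le mult_left_mono order_trans)
    qed
    note noise = gradient_noise[OF history(2) random_variables(1) meas[OF cont(3)] kappa_g(2)
        gradient(1) gradient(2)]
    have D_int: "integrable P D" and D_le: "expectation D \<le> M"
      unfolding D_def by (rule noise, assumption)+
    have w\<delta>: "integrable P (\<lambda>\<xi>. w \<xi> \<bullet> ?\<delta> \<xi>)" "expectation (\<lambda>\<xi>. w \<xi> \<bullet> ?\<delta> \<xi>) = 0"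
      by (rule noise(3,4)[OF _ w w_le], assumption+)+
    have "expectation (\<phi> (Suc k))
        \<le> expectation (\<lambda>\<xi>. \<phi> k \<xi> - C * R k \<xi> - w \<xi> \<bullet> ?\<delta> \<xi> + ?b^2 * (p + q * D \<xi>))"
      using \<phi>_int R_int w\<delta>(1) D_int by (intro integral_mono decrease) auto
    also have "\<dots> = expectation (\<phi> k) - C * expectation (R k) + ?b^2 * (p + q * expectation D)"
      using \<phi>_int R_int w\<delta> D_int by (simp add: prob_space)
    also have "\<dots> \<le> expectation (\<phi> k) - C * expectation (R k) + ?b^2 * \<kappa>\<^sub>1"
      unfolding pq[symmetric] using D_le q by (intro add_left_mono mult_left_mono) auto
    finally show ?thesis .
  qed
  have telescope: "expectation (\<phi> n) + C * (\<Sum>k<n. expectation (R k))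
      \<le> expectation (\<phi> 0) + (\<Sum>k<n. (\<beta> k)^2) * \<kappa>\<^sub>1" for n
  proof (induction n)
    case (Suc n)
    then show ?case using step[of n] by (simp add: algebra_simps)
  qed simp
  have "\<phi> 0 \<xi> = \<tau>\<^sub>m\<^sub>i\<^sub>n * f x0 + norm (c x0)" if "\<xi> \<in> space P" for \<xi>
    using that by (simp add: \<phi>_def start)
  then have "expectation (\<phi> 0) = expectation (\<lambda>_. \<tau>\<^sub>m\<^sub>i\<^sub>n * f x0 + norm (c x0))"
    by (intro Bochner_Integration.integral_cong) auto
  then have \<phi>0: "expectation (\<phi> 0) = \<tau>\<^sub>m\<^sub>i\<^sub>n * f x0 + norm (c x0)" by (simp add: prob_space)
  have "expectation (\<lambda>_. \<tau>\<^sub>m\<^sub>i\<^sub>n * f_inf) \<le> expectation (\<phi> K)"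
    using \<phi>_int merit(3) f_inf
    by (intro integral_mono) (auto simp: \<phi>_def intro!: add_increasing2 mult_left_mono)
  then have \<phi>K: "\<tau>\<^sub>m\<^sub>i\<^sub>n * f_inf \<le> expectation (\<phi> K)" by (simp add: prob_space)
  \<comment> \<open>The scaling \<open>\<eta> / sqrt K\<close> makes the \<open>K\<close> squares
    add up to \<open>\<eta>^2\<close>, so the accumulated remainder does not grow with
    \<open>K\<close>.\<close>
  have "(\<Sum>k<K. (\<beta> k)^2) = (\<Sum>k<K. \<eta>^2 / real K)"
    by (intro sum.cong) (auto simp: beta_const power_divide)
  also have "\<dots> = \<eta>^2" using K by simp
  finally have "C * (\<Sum>k<K. expectation (R k)) \<le> \<kappa>\<^sub>2"
    using telescope[of K] \<phi>0 \<phi>K by (simp add: kappa_2 algebra_simps)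
  then have "(\<Sum>k<K. expectation (R k)) \<le> \<kappa>\<^sub>2 / C" using C by (simp add: field_simps)
  also have "\<kappa>\<^sub>2 / C = 2 * \<kappa>\<^sub>c * \<kappa>\<^sub>2 / (\<nu> * \<sigma> * \<kappa>\<^sub>v)"
    using kappa_c(1) by (simp add: C_def field_simps)
  finally have "1 / real K * (\<Sum>k<K. expectation (R k)) \<le> 1 / real K * (2 * \<kappa>\<^sub>c * \<kappa>\<^sub>2 / (\<nu> * \<sigma> * \<kappa>\<^sub>v))"
    by (intro mult_left_mono) auto
  then show ?thesis by (simp add: R_def[abs_def] mult_ac)
qed

end
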